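(* The finitely generated intersection problem for the monogenic free inverse semigroup $FI_1$ as a semigroup is decidable. That is, there is an algorithm which, given two finite subsets $X,Y\subseteq FI_1$, decides whether the intersection $\langle X\rangle\cap\langle Y\rangle$ of the subsemigroups $\langle X\rangle$ and $\langle Y\rangle$ of $FI_1$ that they generate is finitely generated as a semigroup.
   Context: $FI_1$ is the free inverse semigroup on one generator, realised concretely as $$FI_1=\{(-a,x,b)\in\mathbb{Z}^3 : a,b\ge 0,\ a+b>0,\ -a\le x\le b\}$$ with multiplication $(-a_1,x_1,b_1)(-a_2,x_2,b_2)=(-\max(a_1,a_2-x_1),\,x_1+x_2,\,\max(b_1,b_2+x_1))$ and inverse $(-a,x,b)^{-1}=(-(a+x),-x,b-x)$; the triple $(0,1,1)$ freely generates it as an inverse semigroup. Subsemigroup means a subset closed under multiplication (not necessarily under inverses); $\langle X\rangle$ is the subsemigroup generated by $X$. The empty set is regarded as a finitely generated subsemigroup. The finitely generated intersection problem for a semigroup $U$ asks: is it algorithmically decidable whether the intersection of two given finitely generated subsemigroups of $U$ (given by finite generating sets) is finitely generated? *)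

theory Defs
  imports Main "HOL.Hull" "HOL-Library.Nat_Bijection"
begin

section \<open>Semigroups\<close>

definition subsemigroup :: "'a::semigroup_mult set \<Rightarrow> bool" where
  "subsemigroup S \<longleftrightarrow> (\<forall>a\<in>S. \<forall>b\<in>S. a * b \<in> S)"

text \<open>
  The subsemigroup generated by \<open>X\<close> is \<open>subsemigroup hull X\<close>. The empty set is a subsemigroup,
  and it is finitely generated (by itself).
\<close>

definition finitely_generated :: "'a::semigroup_mult set \<Rightarrow> bool" where
  "finitely_generated S \<longleftrightarrow> (\<exists>A. finite A \<and> S = subsemigroup hull A)"

lemma subsemigroup_hull: "subsemigroup (subsemigroup hull X)"
  by (rule hull_in) (auto simp: subsemigroup_def)

lemma finitely_generated_empty: "finitely_generated ({} :: 'a::semigroup_mult set)"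
  unfolding finitely_generated_def
  by (rule exI[of _ "{}"]) (simp add: hull_same subsemigroup_def)


section \<open>The monogenic free inverse semigroup\<close>

typedef fi1 = "{(- a, x, b) | a x b :: int. a \<ge> 0 \<and> b \<ge> 0 \<and> a + b > 0 \<and> - a \<le> x \<and> x \<le> b}"
  by (rule exI[of _ "(0, 1, 1)"]) force

setup_lifting type_definition_fi1

instantiation fi1 :: semigroup_mult
begin

text \<open>The first coordinates are \<open>p = - a\<close>, whence the signs inside \<open>max\<close>.\<close>

lift_definition times_fi1 :: "fi1 \<Rightarrow> fi1 \<Rightarrow> fi1" is
  "\<lambda>(p\<^sub>1, x\<^sub>1, b\<^sub>1) (p\<^sub>2, x\<^sub>2, b\<^sub>2). (- max (- p\<^sub>1) (- p\<^sub>2 - x\<^sub>1), x\<^sub>1 + x\<^sub>2, max b\<^sub>1 (b\<^sub>2 + x\<^sub>1))"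
  by fastforce

instance
  by standard (transfer, auto simp: max_def)

end


section \<open>Recursive functions and decidability\<close>

text \<open>
  The total recursive functions of arity \<open>n\<close>: the least class containing the zero, successor and
  projection functions and closed under composition, primitive recursion and minimisation of
  regular functions. An \<open>n\<close>-ary function is represented by its values on lists of length \<open>n\<close>;
  rule \<open>cong\<close> makes its values on all other lists irrelevant.
\<close>

inductive recursive :: "nat \<Rightarrow> (nat list \<Rightarrow> nat) \<Rightarrow> bool" where
  zero: "recursive n (\<lambda>_. 0)"
| succ: "recursive 1 (\<lambda>xs. Suc (xs ! 0))"
| proj: "i < n \<Longrightarrow> recursive n (\<lambda>xs. xs ! i)"
| comp: "recursive (length gs) f \<Longrightarrow> (\<forall>g\<in>set gs. recursive n g) \<Longrightarrow>
    recursive n (\<lambda>xs. f (map (\<lambda>g. g xs) gs))"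
| prec: "recursive n f \<Longrightarrow> recursive (Suc (Suc n)) g \<Longrightarrow>
    recursive (Suc n) (\<lambda>xs. rec_nat (f (tl xs)) (\<lambda>k r. g (k # r # tl xs)) (hd xs))"
| minim: "recursive (Suc n) f \<Longrightarrow> (\<forall>xs. length xs = n \<longrightarrow> (\<exists>k. f (k # xs) = 0)) \<Longrightarrow>
    recursive n (\<lambda>xs. LEAST k. f (k # xs) = 0)"
| cong: "recursive n f \<Longrightarrow> (\<forall>xs. length xs = n \<longrightarrow> f xs = g xs) \<Longrightarrow> recursive n g"

text \<open>
  A property \<open>P\<close> of the instances in \<open>I\<close>, presented to the algorithm by their codes \<open>enc i\<close>,
  is decidable if a recursive function computes its characteristic function.
\<close>

definition decidable :: "('i \<Rightarrow> nat) \<Rightarrow> 'i set \<Rightarrow> ('i \<Rightarrow> bool) \<Rightarrow> bool" where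
  "decidable enc I P \<longleftrightarrow>
    (\<exists>f. recursive 1 f \<and> (\<forall>i\<in>I. f [enc i] = (if P i then 1 else 0)))"

definition fi1_encode :: "fi1 \<Rightarrow> nat" where
  "fi1_encode u = (case Rep_fi1 u of (p, x, b) \<Rightarrow>
    prod_encode (int_encode p, prod_encode (int_encode x, int_encode b)))"

text \<open>A finite set is coded by the canonical index \<open>\<Sum>2\<^sup>c\<close> over the codes \<open>c\<close> of its elements.\<close>

definition fi1_sets_encode :: "fi1 set \<times> fi1 set \<Rightarrow> nat" where
  "fi1_sets_encode = (\<lambda>(X, Y).
    prod_encode (set_encode (fi1_encode ` X), set_encode (fi1_encode ` Y)))"

lemma inj_fi1_encode: "inj fi1_encode"
  by (rule injI) (auto simp: fi1_encode_def prod_encode_eq int_encode_eq Rep_fi1_inject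
      split: prod.splits intro: Rep_fi1_inject[THEN iffD1])

lemma inj_on_fi1_sets_encode: "inj_on fi1_sets_encode {(X, Y). finite X \<and> finite Y}"
  by (rule inj_onI)
    (auto simp: fi1_sets_encode_def prod_encode_eq set_encode_eq inj_image_eq_iff[OF inj_fi1_encode])

end

theory Submission
  imports Defs
begin

text \<open>
  An element \<open>(-a, x, b)\<close> is an interval of length \<open>a + b\<close> with a marked start and a marked end.
  To multiply two elements, place the second so that it starts where the first ends, and take the
  union of the two intervals. So a product is at least as wide as its factors, and there are
  finitely many elements of each width. Therefore a subsemigroup \<open>U\<close> is finitely generated iff all
  its elements of sufficiently large width are products of elements of \<open>U\<close> of smaller width, that
  is, iff there are only finitely many \<^emph>\<open>critical\<close> widths \<open>w\<close>, at which some element of \<open>U\<close> is not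
  such a product (lemma \<open>finitely_generated_iff_finite_critical\<close>).

  Place elements on the chain of points \<open>0, \<dots>, n - 1\<close>. An interval with its marks belongs to
  \<open>\<langle>X\<rangle>\<close> iff a walk along placed generators leads from its start to its end, stays inside it, and
  touches both its borders. Reachability means membership in all sets closed under the steps, so this
  is a property of the chain in monadic second-order logic. The same holds for \<open>\<langle>X\<rangle> \<inter> \<langle>Y\<rangle>\<close>, and
  again for walks along those elements of \<open>\<langle>X\<rangle> \<inter> \<langle>Y\<rangle>\<close> that are shorter than the whole chain. As a
  result, a single formula, in which \<open>X\<close> and \<open>Y\<close> enter only through the atoms ``this is a placed
  generator'', holds in the chain of \<open>n\<close> points iff \<open>n - 1\<close> is critical for \<open>\<langle>X\<rangle> \<inter> \<langle>Y\<rangle>\<close>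
  (lemma \<open>holds_critical_formula\<close>).

  Two inductions on formulas finish the proof. First, as in Buechi's theorem, the formulas of bounded
  quantifier rank that hold in a chain are determined by its \<^emph>\<open>type\<close>. The type of a chain determines
  that of the chain with one more point, and the number of types is bounded by a recursive function
  \<open>K\<close> of the sizes of the generators. So the types of the chains are eventually periodic, and the formula
  holds in infinitely many chains iff it holds in one with \<open>K \<le> n < 2 K\<close> points
  (lemma \<open>infinite_holds_iff\<close>). Second, all quantifiers range over the points and subsets of a
  finite chain, so truth of a fixed formula in a given chain is a recursive predicate
  (lemma \<open>recursive_holds\<close>). The algorithm tests the formula at these finitely many \<open>n\<close>.
\<close>

section \<open>Elements as marked intervals\<close>

definition start_of :: "fi1 \<Rightarrow> nat" where
  "start_of u = (case Rep_fi1 u of (p, x, b) \<Rightarrow> nat (- p))"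
definition end_of :: "fi1 \<Rightarrow> nat" where
  "end_of u = (case Rep_fi1 u of (p, x, b) \<Rightarrow> nat (x - p))"
definition width :: "fi1 \<Rightarrow> nat" where
  "width u = (case Rep_fi1 u of (p, x, b) \<Rightarrow> nat (b - p))"

text \<open>
  The shape of an element consists of the offsets of its two marks from the left border and of its
  width. All three are natural numbers, which later serve as positions on a chain.
\<close>

definition shape :: "fi1 \<Rightarrow> nat \<times> nat \<times> nat" where
  "shape u = (start_of u, end_of u, width u)"

lemma Rep_fi1_shape:
  "Rep_fi1 u = (- int (start_of u), int (end_of u) - int (start_of u), int (width u) - int (start_of u))"
  "start_of u \<le> width u" "end_of u \<le> width u" "0 < width u"
  using Rep_fi1[of u]
  by (auto simp: start_of_def end_of_def width_def split: prod.splits)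

lemma ex_shape:
  assumes "s \<le> w" "e \<le> w" "0 < w"
  shows "\<exists>u. shape u = (s, e, w)"
proof -
  have "(- int s, int e - int s, int w - int s) \<in>
      {(- a, x, b) | a x b :: int. a \<ge> 0 \<and> b \<ge> 0 \<and> a + b > 0 \<and> - a \<le> x \<and> x \<le> b}"
    using assms by auto
  then have "Rep_fi1 (Abs_fi1 (- int s, int e - int s, int w - int s)) =
      (- int s, int e - int s, int w - int s)"
    by (rule Abs_fi1_inverse)
  then show ?thesis
    by (intro exI[of _ "Abs_fi1 (- int s, int e - int s, int w - int s)"])
      (simp add: shape_def start_of_def end_of_def width_def)
qed

lemma inj_shape: "inj shape"
  by (rule injI, rule Rep_fi1_inject[THEN iffD1]) (simp add: shape_def Rep_fi1_shape)

text \<open>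
  A placed element is an arrow from the point \<open>s\<close> to the point \<open>e\<close> that occupies \<open>[l, r]\<close>. Products of
  placed elements are compositions of arrows, without the shifts in the multiplication of triples.
\<close>

definition placed :: "fi1 \<Rightarrow> nat \<Rightarrow> nat \<Rightarrow> nat \<Rightarrow> nat \<Rightarrow> bool" where
  "placed u l s e r \<longleftrightarrow> s = l + start_of u \<and> e = l + end_of u \<and> r = l + width u"

lemma placed_bounds:
  assumes "placed u l s e r"
  shows "l \<le> s" "s \<le> r" "l \<le> e" "e \<le> r" "l < r"
  using assms Rep_fi1_shape(2-4)[of u] by (auto simp: placed_def)

lemma Rep_fi1_times:
  assumes "Rep_fi1 u = (p, x, b)" "Rep_fi1 v = (p', x', b')"
  shows "Rep_fi1 (u * v) = (- max (- p) (- p' - x), x + x', max b (b' + x))"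
  using assms by (simp add: times_fi1.rep_eq)

lemma placed_times:
  assumes "placed u l s y r" "placed v l' y e r'"
  shows "placed (u * v) (min l l') s e (max r r')"
  using assms Rep_fi1_times[OF Rep_fi1_shape(1) Rep_fi1_shape(1), of u v]
  unfolding placed_def start_of_def[of "u * v"] end_of_def[of "u * v"] width_def[of "u * v"]
  by (auto simp: min_def max_def split: if_splits)

text \<open>
  Any placement of a product induces placements of its factors. They stay within the natural numbers
  because each factor covers a part of the interval of the product.
\<close>

lemma placed_times_split:
  assumes "placed (u * v) l s e r"
  obtains l1 l2 y r1 r2 where "placed u l1 s y r1" "placed v l2 y e r2"
    "l = min l1 l2" "r = max r1 r2"
proof -
  have "start_of (u * v) \<ge> start_of u" "start_of (u * v) + end_of u \<ge> start_of u + start_of v"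
    using Rep_fi1_times[OF Rep_fi1_shape(1) Rep_fi1_shape(1), of u v]
    unfolding start_of_def[of "u * v"] by (auto simp: max_def split: if_splits)
  then have u: "placed u (s - start_of u) s (s - start_of u + end_of u) (s - start_of u + width u)"
    and v: "placed v (s - start_of u + end_of u - start_of v) (s - start_of u + end_of u)
      (s - start_of u + end_of u - start_of v + end_of v)
      (s - start_of u + end_of u - start_of v + width v)"
    using assms by (auto simp: placed_def)
  have "e = s - start_of u + end_of u - start_of v + end_of v"
    using assms Rep_fi1_times[OF Rep_fi1_shape(1) Rep_fi1_shape(1), of u v] \<open>start_of (u * v) \<ge> start_of u\<close>
      \<open>start_of (u * v) + end_of u \<ge> start_of u + start_of v\<close>
    unfolding placed_def end_of_def[of "u * v"] start_of_def[of "u * v"] by auto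
  with v have v: "placed v (s - start_of u + end_of u - start_of v) (s - start_of u + end_of u) e
      (s - start_of u + end_of u - start_of v + width v)"
    by simp
  from placed_times[OF u v] assms show thesis
    by (intro that[OF u v]) (auto simp: placed_def)
qed

definition arrows :: "fi1 set \<Rightarrow> nat \<Rightarrow> nat \<Rightarrow> nat \<Rightarrow> nat \<Rightarrow> bool" where
  "arrows S l s e r \<longleftrightarrow> (\<exists>u\<in>S. placed u l s e r)"

section \<open>Generated subsemigroups as walks\<close>

text \<open>
  A walk starts at \<open>s\<close> and follows arrows \<open>G lo y z hi\<close>, each of which leads from \<open>y\<close> to \<open>z\<close> and
  occupies \<open>[lo, hi]\<close>, inside \<open>[l, r]\<close>. The flags record whether it has touched \<open>l\<close> and \<open>r\<close>: a
  product is determined by its marks and by the union of the intervals of its factors, so this is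
  all that matters besides the current point.
\<close>

inductive walk :: "(nat \<Rightarrow> nat \<Rightarrow> nat \<Rightarrow> nat \<Rightarrow> bool) \<Rightarrow> nat \<Rightarrow> nat \<Rightarrow> nat \<Rightarrow>
    bool \<Rightarrow> bool \<Rightarrow> nat \<Rightarrow> bool" for G l r s where
  start: "walk G l r s False False s"
| step: "walk G l r s a b y \<Longrightarrow> G lo y z hi \<Longrightarrow> l \<le> lo \<Longrightarrow> hi \<le> r \<Longrightarrow>
    walk G l r s (a \<or> lo = l) (b \<or> hi = r) z"

text \<open>
  An element of the hull can replace a step of a walk. This form is closed under products because
  it quantifies over all walks that precede the step.
\<close>

lemma walk_of_hull:
  assumes "u \<in> subsemigroup hull A"
  shows "\<forall>l r s a b lo y z hi. walk (arrows A) l r s a b y \<longrightarrow> placed u lo y z hi \<longrightarrow> l \<le> lo \<longrightarrow> hi \<le> r \<longrightarrow>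
    walk (arrows A) l r s (a \<or> lo = l) (b \<or> hi = r) z" (is "?P u")
proof (rule hull_induct[where P = ?P, OF assms])
  show "?P u" if "u \<in> A" for u
    using that by (auto intro!: walk.step simp: arrows_def)
  show "subsemigroup {u. ?P u}"
    unfolding subsemigroup_def
  proof (intro ballI CollectI allI impI, elim CollectE)
    fix u v l r s a b lo y z hi
    assume u: "\<forall>l r s a b lo y z hi. walk (arrows A) l r s a b y \<longrightarrow> placed u lo y z hi \<longrightarrow> l \<le> lo \<longrightarrow>
        hi \<le> r \<longrightarrow> walk (arrows A) l r s (a \<or> lo = l) (b \<or> hi = r) z"
      and v: "\<forall>l r s a b lo y z hi. walk (arrows A) l r s a b y \<longrightarrow> placed v lo y z hi \<longrightarrow> l \<le> lo \<longrightarrow>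
        hi \<le> r \<longrightarrow> walk (arrows A) l r s (a \<or> lo = l) (b \<or> hi = r) z"
      and w: "walk (arrows A) l r s a b y" and "placed (u * v) lo y z hi" "l \<le> lo" "hi \<le> r"
    then obtain l1 l2 m r1 r2 where p: "placed u l1 y m r1" "placed v l2 m z r2"
      and lr: "lo = min l1 l2" "hi = max r1 r2"
      by (elim placed_times_split)
    have "walk (arrows A) l r s (a \<or> l1 = l) (b \<or> r1 = r) m"
      using u w p(1) lr \<open>l \<le> lo\<close> \<open>hi \<le> r\<close> by auto
    then have "walk (arrows A) l r s ((a \<or> l1 = l) \<or> l2 = l) ((b \<or> r1 = r) \<or> r2 = r) z"
      using v p(2) lr \<open>l \<le> lo\<close> \<open>hi \<le> r\<close> by (metis max.bounded_iff min.bounded_iff)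
    moreover have "((a \<or> l1 = l) \<or> l2 = l) = (a \<or> lo = l)" "((b \<or> r1 = r) \<or> r2 = r) = (b \<or> hi = r)"
      using lr \<open>l \<le> lo\<close> \<open>hi \<le> r\<close> by auto
    ultimately show "walk (arrows A) l r s (a \<or> lo = l) (b \<or> hi = r) z" by simp
  qed
qed

text \<open>
  The invariant of a nonempty walk: the product of the elements used so far is placed inside
  \<open>[l, r]\<close>, and the flags say which borders it reaches.
\<close>

lemma hull_of_walk:
  assumes "walk (arrows A) l r s a b y"
  shows "(y = s \<and> \<not> a \<and> \<not> b) \<or> (\<exists>u\<in>subsemigroup hull A. \<exists>lo hi. placed u lo s y hi \<and>
    l \<le> lo \<and> hi \<le> r \<and> a = (lo = l) \<and> b = (hi = r))"
  using assms
proof (induction rule: walk.induct)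
  case start
  then show ?case by simp
next
  case (step a b y lo z hi)
  from step.hyps(2) obtain v where v: "v \<in> A" "placed v lo y z hi" by (auto simp: arrows_def)
  from step.IH show ?case
  proof (elim disjE conjE bexE exE)
    assume "y = s" "\<not> a" "\<not> b"
    with v step.hyps show ?thesis by (auto intro: hull_inc)
  next
    fix u lo' hi' assume u: "u \<in> subsemigroup hull A" "placed u lo' s y hi'"
      "l \<le> lo'" "hi' \<le> r" "a = (lo' = l)" "b = (hi' = r)"
    have "u * v \<in> subsemigroup hull A"
      using subsemigroup_hull[of A] u(1) hull_inc[OF v(1), of subsemigroup]
      by (auto simp: subsemigroup_def)
    moreover have "placed (u * v) (min lo' lo) s z (max hi' hi)"
      using placed_times u(2) v(2) by blast
    moreover have "(a \<or> lo = l) = (min lo' lo = l)" "(b \<or> hi = r) = (max hi' hi = r)"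
      using u step.hyps by auto
    moreover have "l \<le> min lo' lo" "max hi' hi \<le> r" using u step.hyps by simp_all
    ultimately show ?thesis by blast
  qed
qed

lemma arrows_hull_iff_walk:
  "arrows (subsemigroup hull A) l s e r \<longleftrightarrow> walk (arrows A) l r s True True e"
proof
  assume "arrows (subsemigroup hull A) l s e r"
  then obtain u where "u \<in> subsemigroup hull A" "placed u l s e r" by (auto simp: arrows_def)
  then show "walk (arrows A) l r s True True e"
    using walk_of_hull walk.start by fastforce
next
  assume "walk (arrows A) l r s True True e"
  from hull_of_walk[OF this] show "arrows (subsemigroup hull A) l s e r"
    by (auto simp: arrows_def)
qed

section \<open>Critical widths\<close>

definition critical :: "fi1 set \<Rightarrow> nat \<Rightarrow> bool" where
  "critical U w \<longleftrightarrow> (\<exists>u\<in>U. width u = w \<and> u \<notin> subsemigroup hull {v \<in> U. width v < w})"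

lemma finite_width_le: "finite {u. width u \<le> N}"
proof (rule inj_on_finite[of shape])
  show "inj_on shape {u. width u \<le> N}" using inj_shape by (rule inj_on_subset) simp
  show "shape ` {u. width u \<le> N} \<subseteq> {..N} \<times> {..N} \<times> {..N}"
    using Rep_fi1_shape(2,3) by (fastforce simp: shape_def intro: order_trans)
qed simp

text \<open>
  If \<open>A\<close> generates \<open>U\<close>, then widths beyond all those in \<open>A\<close> are not critical. Conversely, if no
  width above \<open>N\<close> is critical, induction on the width shows that the finitely many elements of \<open>U\<close>
  of width at most \<open>N\<close> generate \<open>U\<close>.
\<close>

lemma finitely_generated_iff_finite_critical:
  assumes U: "subsemigroup U"
  shows "finitely_generated U \<longleftrightarrow> finite {w. critical U w}"
proof
  assume "finitely_generated U"
  then obtain A where A: "finite A" "U = subsemigroup hull A" by (auto simp: finitely_generated_def)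
  have "w \<le> Max (width ` A)" if "critical U w" for w
  proof (rule ccontr)
    assume "\<not> w \<le> Max (width ` A)"
    then have "width v < w" if "v \<in> A" for v
      using A(1) that by (meson Max_ge finite_imageI image_eqI leD leI less_le_trans)
    then have "A \<subseteq> {v \<in> U. width v < w}"
      using hull_subset[of A subsemigroup] unfolding A(2) by blast
    then have "U \<subseteq> subsemigroup hull {v \<in> U. width v < w}"
      unfolding A(2) by (rule hull_mono)
    with that show False by (auto simp: critical_def)
  qed
  then show "finite {w. critical U w}" by (auto intro: finite_subset[of _ "{..Max (width ` A)}"])
next
  assume "finite {w. critical U w}"
  then obtain N where N: "\<And>w. critical U w \<Longrightarrow> w \<le> N"
    unfolding finite_nat_set_iff_bounded_le by blast
  let ?A = "{u \<in> U. width u \<le> N}"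
  have "u \<in> subsemigroup hull ?A" if "u \<in> U" for u
    using that
  proof (induction "width u" arbitrary: u rule: less_induct)
    case less
    show ?case
    proof (cases "width u \<le> N")
      case True
      with less.prems show ?thesis by (auto intro: hull_inc)
    next
      case False
      with N have "\<not> critical U (width u)" by blast
      with less.prems have "u \<in> subsemigroup hull {v \<in> U. width v < width u}"
        unfolding critical_def by blast
      also have "\<dots> \<subseteq> subsemigroup hull (subsemigroup hull ?A)"
        using less.hyps by (intro hull_mono subsetI) simp
      finally show ?thesis by (simp only: hull_hull)
    qed
  qed
  moreover have "subsemigroup hull ?A \<subseteq> U" using U by (intro hull_minimal) auto
  ultimately have "U = subsemigroup hull ?A" by blast
  moreover have "finite ?A" by (rule finite_subset[OF _ finite_width_le[of N]]) auto
  ultimately show "finitely_generated U" by (auto simp: finitely_generated_def)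
qed

text \<open>
  An element of width \<open>w\<close> can be placed on \<open>[0, w]\<close>. Inside this interval, the elements of smaller
  width are those that do not fill all of it.
\<close>

lemma critical_iff_walk:
  assumes U: "subsemigroup U"
  shows "critical U w \<longleftrightarrow> (\<exists>s e. arrows U 0 s e w \<and>
    \<not> walk (\<lambda>lo y z hi. arrows U lo y z hi \<and> \<not> (lo = 0 \<and> hi = w)) 0 w s True True e)"
proof -
  have restrict: "walk (arrows {v \<in> U. width v < w}) 0 w s a b e \<longleftrightarrow>
      walk (\<lambda>lo y z hi. arrows U lo y z hi \<and> \<not> (lo = 0 \<and> hi = w)) 0 w s a b e"
    (is "walk ?F 0 w s a b e = walk ?G 0 w s a b e") for s a b e
  proof
    show "walk ?G 0 w s a b e" if "walk ?F 0 w s a b e"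
      using that
      by induction (force simp: arrows_def placed_def intro: walk.start walk.step)+
    show "walk ?F 0 w s a b e" if "walk ?G 0 w s a b e"
      using that
      by induction (force simp: arrows_def placed_def intro: walk.start walk.step)+
  qed
  have "critical U w \<longleftrightarrow> (\<exists>s e. arrows U 0 s e w \<and>
      \<not> arrows (subsemigroup hull {v \<in> U. width v < w}) 0 s e w)"
  proof
    assume "critical U w"
    then obtain u where u: "u \<in> U" "width u = w" "u \<notin> subsemigroup hull {v \<in> U. width v < w}"
      by (auto simp: critical_def)
    then have p: "placed u 0 (start_of u) (end_of u) w" by (auto simp: placed_def)
    moreover have "v = u" if "placed v 0 (start_of u) (end_of u) w" for v
      using that p by (intro injD[OF inj_shape]) (auto simp: placed_def shape_def)
    ultimately show "\<exists>s e. arrows U 0 s e w \<and>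
        \<not> arrows (subsemigroup hull {v \<in> U. width v < w}) 0 s e w"
      using u by (auto simp: arrows_def)
  next
    assume "\<exists>s e. arrows U 0 s e w \<and> \<not> arrows (subsemigroup hull {v \<in> U. width v < w}) 0 s e w"
    then show "critical U w" by (auto simp: arrows_def placed_def critical_def)
  qed
  then show ?thesis by (simp add: arrows_hull_iff_walk restrict)
qed

section \<open>Monadic second-order formulas over finite chains\<close>

text \<open>
  All variables stand for sets of points, and singletons represent points. \<open>Meets\<close> and \<open>Before\<close>
  then express equality, membership and order; \<open>Arrow\<close> refers to one of two sets of shapes, which
  are parameters of the semantics.
\<close>

datatype formula =
    Meets nat nat
  | Before nat nat
  | Arrow bool nat nat nat nat
  | Neg formula
  | Conj formula formula
  | Exists nat formula

definition meets_shifted :: "nat \<Rightarrow> nat set \<Rightarrow> nat set \<Rightarrow> bool" where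
  "meets_shifted c A B \<longleftrightarrow> (\<exists>x\<in>A. x + c \<in> B)"

primrec holds :: "(bool \<Rightarrow> (nat \<times> nat \<times> nat) set) \<Rightarrow> nat \<Rightarrow> formula \<Rightarrow> (nat \<Rightarrow> nat set) \<Rightarrow> bool" where
  "holds T n (Meets i j) V = meets_shifted 0 (V i) (V j)"
| "holds T n (Before i j) V = (\<exists>x\<in>V i. \<exists>y\<in>V j. x < y)"
| "holds T n (Arrow b i j k h) V = (\<exists>(s, e, w)\<in>T b.
    meets_shifted s (V i) (V j) \<and> meets_shifted e (V i) (V k) \<and> meets_shifted w (V i) (V h))"
| "holds T n (Neg F) V = (\<not> holds T n F V)"
| "holds T n (Conj F G) V = (holds T n F V \<and> holds T n G V)"
| "holds T n (Exists i F) V = (\<exists>W\<subseteq>{..<n}. holds T n F (V(i := W)))"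

primrec rank :: "formula \<Rightarrow> nat" where
  "rank (Meets i j) = 0"
| "rank (Before i j) = 0"
| "rank (Arrow b i j k h) = 0"
| "rank (Neg F) = rank F"
| "rank (Conj F G) = max (rank F) (rank G)"
| "rank (Exists i F) = Suc (rank F)"

primrec vars_below :: "nat \<Rightarrow> formula \<Rightarrow> bool" where
  "vars_below m (Meets i j) = (i < m \<and> j < m)"
| "vars_below m (Before i j) = (i < m \<and> j < m)"
| "vars_below m (Arrow b i j k h) = (i < m \<and> j < m \<and> k < m \<and> h < m)"
| "vars_below m (Neg F) = vars_below m F"
| "vars_below m (Conj F G) = (vars_below m F \<and> vars_below m G)"
| "vars_below m (Exists i F) = (i < m \<and> vars_below m F)"

section \<open>Types and eventual periodicity\<close>

text \<open>
  The atomic facts about a chain of \<open>n\<close> points with sets \<open>V\<close>, of three kinds: a shift of one set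
  meets another, some point of one set precedes some point of another, and a set contains the
  point at distance \<open>c\<close> from the end. The last kind tells which shifts will meet a set once a
  further point of the chain belongs to it.
\<close>

definition fact_holds :: "nat \<Rightarrow> (nat \<Rightarrow> nat set) \<Rightarrow> nat \<Rightarrow> nat \<Rightarrow> nat \<Rightarrow> nat \<Rightarrow> bool" where
  "fact_holds n V t c i j \<longleftrightarrow>
    (if t = 0 then meets_shifted c (V i) (V j)
     else if t = 1 then (\<exists>x\<in>V i. \<exists>y\<in>V j. x < y)
     else 0 < c \<and> c \<le> n \<and> n - c \<in> V i)"

abbreviation tuple_encode :: "nat \<Rightarrow> nat \<Rightarrow> nat \<Rightarrow> nat \<Rightarrow> nat" where
  "tuple_encode t c i j \<equiv> prod_encode (t, prod_encode (c, prod_encode (i, j)))"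

text \<open>
  The type of rank \<open>k\<close> is the usual Hintikka or Ehrenfeucht--Fraisse type, coded as a number: for each
  variable it lists the types of rank \<open>k - 1\<close> reached by reassigning that variable. It includes the type
  of rank \<open>k - 1\<close> itself, because a reassignment loses the old value of the variable.
\<close>

primrec mso_type :: "nat \<Rightarrow> nat \<Rightarrow> nat \<Rightarrow> nat \<Rightarrow> (nat \<Rightarrow> nat set) \<Rightarrow> nat" where
  "mso_type C m 0 n V = set_encode {tuple_encode t c i j | t c i j.
     t \<le> 2 \<and> c \<le> C \<and> i < m \<and> j < m \<and> fact_holds n V t c i j}"
| "mso_type C m (Suc k) n V = prod_encode (mso_type C m k n V,
     set_encode {prod_encode (i, mso_type C m k n (V(i := W))) | i W. i < m \<and> W \<subseteq> {..<n}})"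

primrec mso_type_bound :: "nat \<Rightarrow> nat \<Rightarrow> nat \<Rightarrow> nat" where
  "mso_type_bound C m 0 = 2 ^ Suc (tuple_encode 2 C m m)"
| "mso_type_bound C m (Suc k) =
     Suc (prod_encode (mso_type_bound C m k, 2 ^ Suc (prod_encode (m, mso_type_bound C m k))))"

lemma prod_encode_mono: "a \<le> a' \<Longrightarrow> b \<le> b' \<Longrightarrow> prod_encode (a, b) \<le> prod_encode (a', b')"
proof -
  assume le: "a \<le> a'" "b \<le> b'"
  have "mono triangle" by (simp add: mono_iff_le_Suc)
  then have "triangle (a + b) \<le> triangle (a' + b')"
    using le by (intro monoD[of triangle]) auto
  then show ?thesis using le by (simp add: prod_encode_def)
qed

lemma set_encode_less: 
  assumes "A \<subseteq> {..<N}" shows "set_encode A < 2 ^ N"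
proof -
  have "set_encode A \<le> sum ((^) 2) {..<N}"
    unfolding set_encode_def using assms by (intro sum_mono2) auto
  also have "\<dots> < 2 ^ N" by (induction N) auto
  finally show ?thesis .
qed

lemma facts_bounded: "{tuple_encode t c i j | t c i j.
    t \<le> 2 \<and> c \<le> C \<and> i < m \<and> j < m \<and> fact_holds n V t c i j} \<subseteq> {..<Suc (tuple_encode 2 C m m)}"
  by (auto simp: less_Suc_eq_le intro!: prod_encode_mono)

lemma mso_type_less: "mso_type C m k n V < mso_type_bound C m k"
proof (induction k arbitrary: V)
  case 0
  show ?case unfolding mso_type.simps mso_type_bound.simps by (rule set_encode_less[OF facts_bounded])
next
  case (Suc k)
  have "{prod_encode (i, mso_type C m k n (V(i := W))) | i W. i < m \<and> W \<subseteq> {..<n}}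
      \<subseteq> {..<Suc (prod_encode (m, mso_type_bound C m k))}"
  proof (rule subsetI, elim CollectE exE conjE)
    fix y i W assume y: "y = prod_encode (i, mso_type C m k n (V(i := W)))" and i: "i < m"
    show "y \<in> {..<Suc (prod_encode (m, mso_type_bound C m k))}"
      using prod_encode_mono[OF less_imp_le[OF i] less_imp_le[OF Suc.IH]]
      unfolding y lessThan_iff less_Suc_eq_le .
  qed
  from prod_encode_mono[OF less_imp_le less_imp_le, OF Suc.IH[of V] set_encode_less[OF this]]
  show ?case
    unfolding mso_type.simps mso_type_bound.simps less_Suc_eq_le .
qed

lemma mso_type_0_eq_iff: "mso_type C m 0 n V = mso_type C m 0 n' V' \<longleftrightarrow>
  (\<forall>t\<le>2. \<forall>c\<le>C. \<forall>i<m. \<forall>j<m. fact_holds n V t c i j = fact_holds n' V' t c i j)"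
proof -
  have "finite {tuple_encode t c i j | t c i j.
      t \<le> 2 \<and> c \<le> C \<and> i < m \<and> j < m \<and> fact_holds n V t c i j}" for n V
    using facts_bounded by (rule finite_subset) simp
  then have "mso_type C m 0 n V = mso_type C m 0 n' V' \<longleftrightarrow>
      {tuple_encode t c i j | t c i j.
        t \<le> 2 \<and> c \<le> C \<and> i < m \<and> j < m \<and> fact_holds n V t c i j} =
      {tuple_encode t c i j | t c i j.
        t \<le> 2 \<and> c \<le> C \<and> i < m \<and> j < m \<and> fact_holds n' V' t c i j}"
    unfolding mso_type.simps by (intro set_encode_eq)
  also have "\<dots> \<longleftrightarrow>
      (\<forall>t\<le>2. \<forall>c\<le>C. \<forall>i<m. \<forall>j<m. fact_holds n V t c i j = fact_holds n' V' t c i j)"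
    (is "?A n V = ?A n' V' \<longleftrightarrow> ?R")
  proof
    have mem: "tuple_encode t c i j \<in> ?A n V \<longleftrightarrow>
        t \<le> 2 \<and> c \<le> C \<and> i < m \<and> j < m \<and> fact_holds n V t c i j" for n V t c i j
      by simp
    show ?R if "?A n V = ?A n' V'"
      using mem[of _ _ _ _ n V, unfolded that mem] by blast
    show "?A n V = ?A n' V'" if ?R
      by (intro Collect_cong iff_exI) (use that in auto)
  qed
  finally show ?thesis .
qed

lemma finite_extension_types:
  "finite {prod_encode (i, mso_type C m k n (V(i := W))) | i W. i < m \<and> W \<subseteq> {..<n}}"
proof -
  have "{prod_encode (i, mso_type C m k n (V(i := W))) | i W. i < m \<and> W \<subseteq> {..<n}} =
      (\<lambda>(i, W). prod_encode (i, mso_type C m k n (V(i := W)))) ` ({..<m} \<times> Pow {..<n})"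
    by auto
  then show ?thesis by simp
qed

text \<open>
  Equality of types gives the back-and-forth property of Ehrenfeucht--Fraisse games.
\<close>

lemma mso_type_Suc_eqD:
  assumes "mso_type C m (Suc k) n V = mso_type C m (Suc k) n' V'"
  shows "mso_type C m k n V = mso_type C m k n' V'"
    and "i < m \<Longrightarrow> W \<subseteq> {..<n} \<Longrightarrow> \<exists>W'\<subseteq>{..<n'}. mso_type C m k n (V(i := W)) = mso_type C m k n' (V'(i := W'))"
proof -
  show "mso_type C m k n V = mso_type C m k n' V'" using assms by simp
  assume "i < m" "W \<subseteq> {..<n}"
  then have "prod_encode (i, mso_type C m k n (V(i := W))) \<in>
      {prod_encode (i, mso_type C m k n (V(i := W))) | i W. i < m \<and> W \<subseteq> {..<n}}"
    by blast
  also have "\<dots> = {prod_encode (i, mso_type C m k n' (V'(i := W))) | i W. i < m \<and> W \<subseteq> {..<n'}}"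
    using assms finite_extension_types by (simp add: set_encode_eq del: fun_upd_apply)
  finally show "\<exists>W'\<subseteq>{..<n'}. mso_type C m k n (V(i := W)) = mso_type C m k n' (V'(i := W'))"
    by (auto simp del: fun_upd_apply)
qed

lemma mso_type_eq_imp_mso_type_0_eq: "mso_type C m k n V = mso_type C m k n' V' \<Longrightarrow> mso_type C m 0 n V = mso_type C m 0 n' V'"
  by (induction k) (simp, blast dest: mso_type_Suc_eqD(1))

lemma mso_type_eq_imp_fact_eq:
  assumes "mso_type C m k n V = mso_type C m k n' V'" "t \<le> 2" "c \<le> C" "i < m" "j < m"
  shows "fact_holds n V t c i j = fact_holds n' V' t c i j"
  using mso_type_eq_imp_mso_type_0_eq[OF assms(1)] assms(2-) unfolding mso_type_0_eq_iff by blast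

text \<open>
  The bound \<open>C\<close> makes the types record all shifts that occur in the atoms. Quantifiers are matched by
  the back-and-forth property, at the cost of one rank each.
\<close>

lemma holds_cong_mso_type:
  assumes T: "\<And>b s e w. (s, e, w) \<in> T b \<Longrightarrow> s \<le> C \<and> e \<le> C \<and> w \<le> C"
    and "vars_below m F" "rank F \<le> k" "mso_type C m k n V = mso_type C m k n' V'"
  shows "holds T n F V = holds T n' F V'"
  using assms(2-)
proof (induction F arbitrary: k V V')
  case (Meets i j)
  then show ?case
    using mso_type_eq_imp_fact_eq[OF Meets.prems(3), of 0 0 i j] by (simp add: fact_holds_def)
next
  case (Before i j)
  then show ?case
    using mso_type_eq_imp_fact_eq[OF Before.prems(3), of 1 0 i j] by (simp add: fact_holds_def)
next
  case (Arrow b i j k' h)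
  have "meets_shifted c (V i) (V j) = meets_shifted c (V' i) (V' j)"
    if "c \<le> C" "i < m" "j < m" for c i j
    using mso_type_eq_imp_fact_eq[OF Arrow.prems(3), of 0 c i j] that by (simp add: fact_holds_def)
  then have "meets_shifted s (V i) (V j) \<and> meets_shifted e (V i) (V k') \<and> meets_shifted w (V i) (V h)
      \<longleftrightarrow> meets_shifted s (V' i) (V' j) \<and> meets_shifted e (V' i) (V' k') \<and> meets_shifted w (V' i) (V' h)"
    if "(s, e, w) \<in> T b" for s e w
    using T[OF that] Arrow.prems(1) by simp
  then show ?case by fastforce
next
  case (Neg F)
  then show ?case by simp
next
  case (Conj F G)
  have "holds T n F V = holds T n' F V'" "holds T n G V = holds T n' G V'"
    using Conj.IH(1)[of k V V'] Conj.IH(2)[of k V V'] Conj.prems by simp_all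
  then show ?case by simp
next
  case (Exists i F)
  then obtain k' where k: "k = Suc k'" "rank F \<le> k'" by (cases k) auto
  have i: "i < m" and IH: "\<And>V V'. mso_type C m k' n V = mso_type C m k' n' V' \<Longrightarrow> holds T n F V = holds T n' F V'"
    using Exists.IH[OF _ k(2)] Exists.prems(1) by simp_all
  have eq: "mso_type C m (Suc k') n V = mso_type C m (Suc k') n' V'" using Exists.prems(3) k(1) by simp
  show ?case
  proof
    assume "holds T n (Exists i F) V"
    then obtain W where "W \<subseteq> {..<n}" "holds T n F (V(i := W))" by auto
    then show "holds T n' (Exists i F) V'"
      using mso_type_Suc_eqD(2)[OF eq i, of W] IH[of "V(i := W)"] by auto
  next
    assume "holds T n' (Exists i F) V'"
    then obtain W where "W \<subseteq> {..<n'}" "holds T n' F (V'(i := W))" by auto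
    then show "holds T n (Exists i F) V"
      using mso_type_Suc_eqD(2)[OF eq[symmetric] i, of W] IH[of _ "V'(i := W)"] by (auto dest: sym)
  qed
qed

definition append_letter :: "nat \<Rightarrow> nat set \<Rightarrow> (nat \<Rightarrow> nat set) \<Rightarrow> nat \<Rightarrow> nat set" where
  "append_letter n L V i = (if i \<in> L then insert n (V i) else V i)"

lemma fact_holds_append_letter:
  assumes V: "\<And>i. V i \<subseteq> {..<n}"
  shows "fact_holds (Suc n) (append_letter n L V) 0 c i j \<longleftrightarrow>
      fact_holds n V 0 c i j \<or> j \<in> L \<and> (if c = 0 then i \<in> L else fact_holds n V 2 c i j)"
    and "fact_holds (Suc n) (append_letter n L V) (Suc 0) c i j \<longleftrightarrow>
      fact_holds n V (Suc 0) c i j \<or> j \<in> L \<and> fact_holds n V 0 0 i i"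
    and "fact_holds (Suc n) (append_letter n L V) 2 c i j \<longleftrightarrow>
      (if c = 1 then i \<in> L else fact_holds n V 2 (c - 1) i j)"
proof -
  have V: "x < n" if "x \<in> V i" for x i using V that by blast
  note [dest] = V
  show "fact_holds (Suc n) (append_letter n L V) 0 c i j \<longleftrightarrow>
      fact_holds n V 0 c i j \<or> j \<in> L \<and> (if c = 0 then i \<in> L else fact_holds n V 2 c i j)"
  proof (cases "c = 0")
    case True
    then show ?thesis
      by (auto simp: fact_holds_def append_letter_def meets_shifted_def)
  next
    case False
    have "(\<exists>x\<in>V i. x + c = n) \<longleftrightarrow> c \<le> n \<and> n - c \<in> V i"
      by (auto intro!: bexI[of _ "n - c"])
    moreover have "x + c \<in> V j \<Longrightarrow> x < n" for x using V by fastforce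
    ultimately show ?thesis using False
      by (auto simp: fact_holds_def append_letter_def meets_shifted_def)
  qed
  show "fact_holds (Suc n) (append_letter n L V) (Suc 0) c i j \<longleftrightarrow>
      fact_holds n V (Suc 0) c i j \<or> j \<in> L \<and> fact_holds n V 0 0 i i"
    by (auto simp: fact_holds_def append_letter_def meets_shifted_def)
  show "fact_holds (Suc n) (append_letter n L V) 2 c i j \<longleftrightarrow>
      (if c = 1 then i \<in> L else fact_holds n V 2 (c - 1) i j)"
    by (cases c) (auto simp: fact_holds_def append_letter_def)
qed

text \<open>
  A set in the longer chain is a set in the shorter one together with the decision whether it
  contains the new point. So a reassignment in the longer chain amounts to one in the shorter
  chain and a change of the letter \<open>L\<close>, and the induction hypothesis for the changed letter applies.
\<close>

lemma mso_type_append_letter: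
  assumes "mso_type C m k n V = mso_type C m k n' V'" "\<And>i. V i \<subseteq> {..<n}" "\<And>i. V' i \<subseteq> {..<n'}"
  shows "mso_type C m k (Suc n) (append_letter n L V) = mso_type C m k (Suc n') (append_letter n' L V')"
  using assms
proof (induction k arbitrary: V V' L)
  case 0
  note eq = mso_type_eq_imp_fact_eq[OF 0(1)]
  have "fact_holds (Suc n) (append_letter n L V) t c i j =
      fact_holds (Suc n') (append_letter n' L V') t c i j"
    if "t \<le> 2" "c \<le> C" "i < m" "j < m" for t c i j
  proof -
    consider "t = 0" | "t = Suc 0" | "t = 2" using \<open>t \<le> 2\<close> by linarith
    then show ?thesis
      using that eq[of 0 c i j] eq[of "Suc 0" c i j] eq[of 2 c i j] eq[of 0 0 i i] eq[of 2 "c - 1" i j]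
      by cases (simp_all add: fact_holds_append_letter[OF 0(2)] fact_holds_append_letter[OF 0(3)])
  qed
  then show ?case unfolding mso_type_0_eq_iff by blast
next
  case (Suc k)
  have split: "\<exists>L' W0. W0 \<subseteq> {..<n} \<and> (\<forall>V. (append_letter n L V)(i := W) = append_letter n L' (V(i := W0)))
    \<and> (\<forall>n' W'. append_letter n' L' (V'(i := W')) =
      (append_letter n' L V')(i := (if n \<in> W then insert n' W' else W')))"
    if "W \<subseteq> {..<Suc n}" for n W i and V' :: "nat \<Rightarrow> nat set"
    \<comment> \<open>The letter decides whether the new point belongs to the set with index \<open>i\<close>.\<close>
    by (rule exI[of _ "if n \<in> W then insert i L else L - {i}"], rule exI[of _ "W - {n}"])
      (use that in \<open>auto simp: append_letter_def fun_eq_iff less_Suc_eq\<close>)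
  have sub: "{prod_encode (i, mso_type C m k (Suc n) ((append_letter n L V)(i := W))) | i W.
        i < m \<and> W \<subseteq> {..<Suc n}} \<subseteq>
      {prod_encode (i, mso_type C m k (Suc n') ((append_letter n' L V')(i := W))) | i W.
        i < m \<and> W \<subseteq> {..<Suc n'}}"
    if eq: "mso_type C m (Suc k) n V = mso_type C m (Suc k) n' V'"
      and V: "\<And>i. V i \<subseteq> {..<n}" and V': "\<And>i. V' i \<subseteq> {..<n'}"
      and IH: "\<And>V V' L. mso_type C m k n V = mso_type C m k n' V' \<Longrightarrow> (\<And>i. V i \<subseteq> {..<n}) \<Longrightarrow>
        (\<And>i. V' i \<subseteq> {..<n'}) \<Longrightarrow>
        mso_type C m k (Suc n) (append_letter n L V) = mso_type C m k (Suc n') (append_letter n' L V')"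
    for n n' V V'
  proof (rule subsetI, elim CollectE exE conjE)
    fix y i W assume y: "y = prod_encode (i, mso_type C m k (Suc n) ((append_letter n L V)(i := W)))"
      and i: "i < m" and W: "W \<subseteq> {..<Suc n}"
    obtain L' W0 where W0: "W0 \<subseteq> {..<n}"
      and 1: "(append_letter n L V)(i := W) = append_letter n L' (V(i := W0))"
      and 2: "\<And>W'. append_letter n' L' (V'(i := W')) =
        (append_letter n' L V')(i := (if n \<in> W then insert n' W' else W'))"
      using split[OF W, of i V'] by blast
    obtain W' where W': "W' \<subseteq> {..<n'}" "mso_type C m k n (V(i := W0)) = mso_type C m k n' (V'(i := W'))"
      using mso_type_Suc_eqD(2)[OF eq i W0] by blast
    have "mso_type C m k (Suc n) (append_letter n L' (V(i := W0))) =
        mso_type C m k (Suc n') (append_letter n' L' (V'(i := W')))"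
      by (rule IH[OF W'(2)]) (use V V' W0 W' in auto)
    then have "y = prod_encode (i, mso_type C m k (Suc n') ((append_letter n' L V')
        (i := (if n \<in> W then insert n' W' else W'))))"
      unfolding y 1 2 by simp
    moreover have "(if n \<in> W then insert n' W' else W') \<subseteq> {..<Suc n'}"
      using W'(1) by auto
    ultimately show "y \<in> {prod_encode (i, mso_type C m k (Suc n') ((append_letter n' L V')(i := W))) | i W.
        i < m \<and> W \<subseteq> {..<Suc n'}}"
      using i by blast
  qed
  have IH': "mso_type C m k n' V' = mso_type C m k n V \<Longrightarrow> (\<And>i. V' i \<subseteq> {..<n'}) \<Longrightarrow> (\<And>i. V i \<subseteq> {..<n}) \<Longrightarrow>
      mso_type C m k (Suc n') (append_letter n' L V') = mso_type C m k (Suc n) (append_letter n L V)" for V V' L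
    using Suc.IH[of V V' L] by simp
  have "mso_type C m k (Suc n) (append_letter n L V) = mso_type C m k (Suc n') (append_letter n' L V')"
    using Suc.IH[OF mso_type_Suc_eqD(1)[OF Suc.prems(1)] Suc.prems(2,3)] .
  moreover have "{prod_encode (i, mso_type C m k (Suc n) ((append_letter n L V)(i := W))) | i W.
        i < m \<and> W \<subseteq> {..<Suc n}} =
      {prod_encode (i, mso_type C m k (Suc n') ((append_letter n' L V')(i := W))) | i W.
        i < m \<and> W \<subseteq> {..<Suc n'}}"
    by (rule equalityI[OF sub[OF Suc.prems Suc.IH] sub[OF Suc.prems(1)[symmetric] Suc.prems(3,2) IH']])
  ultimately show ?case by (simp only: mso_type.simps)
qed

text \<open>
  Among the first \<open>K + 1\<close> values of \<open>t\<close> two agree, so \<open>t\<close> and \<open>P\<close> are periodic from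
  \<open>K\<close> on, with a period of at most \<open>K\<close>.
\<close>

lemma infinite_iff_in_window:
  fixes t :: "nat \<Rightarrow> nat"
  assumes bound: "\<And>n. t n < K" and step: "\<And>n n'. t n = t n' \<Longrightarrow> t (Suc n) = t (Suc n')"
    and P: "\<And>n n'. t n = t n' \<Longrightarrow> P n = P n'"
  shows "infinite {n. P n} \<longleftrightarrow> (\<exists>n<2 * K. K \<le> n \<and> P n)"
proof -
  have "\<not> inj_on t {..K}"
    using card_inj_on_le[of t "{..K}" "{..<K}"] bound by auto
  then obtain i j where "i \<le> K" "j \<le> K" "t i = t j" "i \<noteq> j" unfolding inj_on_def by auto
  then obtain i j where ij: "i < j" "j \<le> K" "t j = t i" by (metis linorder_neqE_nat)
  define p where "p = j - i"
  have p: "p > 0" "i + p \<le> K" "t (i + p) = t i" using ij by (auto simp: p_def)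
  have period: "t (n + p) = t n" if "i \<le> n" for n
    using that
  proof (induction n rule: dec_induct)
    case base then show ?case using p by simp
  next
    case (step n)
    then show ?case using assms(2)[of "n + p" n] by simp
  qed
  have up: "P (n + k * p)" if "i \<le> n" "P n" for n k
  proof (induction k)
    case 0 then show ?case using that by simp
  next
    case (Suc k)
    then show ?case using P[OF period[of "n + k * p"]] that by (simp add: algebra_simps)
  qed
  show ?thesis
  proof
    assume inf: "infinite {n. P n}"
    then obtain n0 where n0: "K \<le> n0 \<and> P n0"
      unfolding finite_nat_set_iff_bounded by (meson mem_Collect_eq not_less)
    define n where "n = (LEAST n. K \<le> n \<and> P n)"
    have n: "K \<le> n" "P n" using LeastI[of "\<lambda>n. K \<le> n \<and> P n", OF n0] by (auto simp: n_def)
    have "n < K + p"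
    proof (rule ccontr)
      assume "\<not> n < K + p"
      then have "K \<le> n - p \<and> P (n - p)"
        using P[OF period[of "n - p"]] n p by auto
      then have "n \<le> n - p" unfolding n_def by (rule Least_le)
      then show False using p \<open>\<not> n < K + p\<close> by linarith
    qed
    then show "\<exists>n<2 * K. K \<le> n \<and> P n" using n p by (intro exI[of _ n]) auto
  next
    assume "\<exists>n<2 * K. K \<le> n \<and> P n"
    then obtain n where n: "K \<le> n" "P n" by blast
    have less: "k < n + Suc k * p" for k using p(1) by (cases p) auto
    have "P (n + Suc k * p)" for k using up[of n "Suc k"] n p by simp
    then show "infinite {n. P n}"
      unfolding finite_nat_set_iff_bounded using less less_asym by blast
  qed
qed

lemma infinite_holds_iff:
  assumes T: "\<And>b s e w. (s, e, w) \<in> T b \<Longrightarrow> s \<le> C \<and> e \<le> C \<and> w \<le> C"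
    and F: "vars_below m F"
  defines "K \<equiv> mso_type_bound C m (rank F)"
  shows "infinite {n. holds T n F (\<lambda>_. {})} \<longleftrightarrow> (\<exists>n<2 * K. K \<le> n \<and> holds T n F (\<lambda>_. {}))"
proof (rule infinite_iff_in_window[where t = "\<lambda>n. mso_type C m (rank F) n (\<lambda>_. {})"])
  have "append_letter n {} (\<lambda>_. {}) = (\<lambda>_. {})" for n
    by (simp add: append_letter_def fun_eq_iff)
  then show "mso_type C m (rank F) (Suc n) (\<lambda>_. {}) = mso_type C m (rank F) (Suc n') (\<lambda>_. {})"
    if "mso_type C m (rank F) n (\<lambda>_. {}) = mso_type C m (rank F) n' (\<lambda>_. {})" for n n'
    using mso_type_append_letter[OF that, of "{}"] by simp
qed (simp add: K_def mso_type_less, rule holds_cong_mso_type[OF T F order_refl])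

section \<open>A formula for critical widths\<close>

definition Impl :: "formula \<Rightarrow> formula \<Rightarrow> formula" where
  "Impl F G = Neg (Conj F (Neg G))"
definition Forall :: "nat \<Rightarrow> formula \<Rightarrow> formula" where
  "Forall i F = Neg (Exists i (Neg F))"
definition Exists_pos :: "nat \<Rightarrow> formula \<Rightarrow> formula" where
  "Exists_pos i F = Exists i (Conj (Conj (Meets i i) (Neg (Before i i))) F)"
definition Forall_pos :: "nat \<Rightarrow> formula \<Rightarrow> formula" where
  "Forall_pos i F = Neg (Exists_pos i (Neg F))"
definition Forall_bool :: "(bool \<Rightarrow> formula) \<Rightarrow> formula" where
  "Forall_bool F = Conj (F True) (F False)"
definition Holds_iff :: "bool \<Rightarrow> formula \<Rightarrow> formula" where
  "Holds_iff b F = (if b then F else Neg F)"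

lemma holds_Impl [simp]: "holds T n (Impl F G) V = (holds T n F V \<longrightarrow> holds T n G V)"
  by (simp add: Impl_def)

lemma holds_Forall [simp]: "holds T n (Forall i F) V = (\<forall>W\<subseteq>{..<n}. holds T n F (V(i := W)))"
  by (simp add: Forall_def)

text \<open>
  A set is a singleton iff it is nonempty and no two of its points are ordered.
\<close>

lemma holds_Exists_pos [simp]: "holds T n (Exists_pos i F) V = (\<exists>x<n. holds T n F (V(i := {x})))"
proof -
  have "meets_shifted 0 W W \<and> \<not> (\<exists>x\<in>W. \<exists>y\<in>W. x < y) \<longleftrightarrow> (\<exists>x. W = {x})" for W :: "nat set"
  proof
    assume "meets_shifted 0 W W \<and> \<not> (\<exists>x\<in>W. \<exists>y\<in>W. x < y)"
    then obtain x where x: "x \<in> W" "\<forall>x\<in>W. \<forall>y\<in>W. \<not> x < y" by (auto simp: meets_shifted_def)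
    then have "W = {x}" by (auto simp: not_less intro: antisym)
    then show "\<exists>x. W = {x}" ..
  qed (auto simp: meets_shifted_def)
  then have "holds T n (Exists_pos i F) V \<longleftrightarrow> (\<exists>W\<subseteq>{..<n}. (\<exists>x. W = {x}) \<and> holds T n F (V(i := W)))"
    by (simp add: Exists_pos_def)
  also have "\<dots> \<longleftrightarrow> (\<exists>x<n. holds T n F (V(i := {x})))"
    by auto
  finally show ?thesis .
qed

lemma holds_Forall_pos [simp]: "holds T n (Forall_pos i F) V = (\<forall>x<n. holds T n F (V(i := {x})))"
  by (simp add: Forall_pos_def)

lemma holds_Forall_bool [simp]: "holds T n (Forall_bool F) V = (\<forall>b. holds T n (F b) V)"
  by (simp add: Forall_bool_def all_bool_eq)

lemma holds_Holds_iff [simp]: "holds T n (Holds_iff b F) V = (holds T n F V = b)"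
  by (simp add: Holds_iff_def)

lemma meets_shifted_singleton [simp]:
  "meets_shifted c {x} {y} \<longleftrightarrow> x + c = y" "meets_shifted 0 {x} B \<longleftrightarrow> x \<in> B"
  by (auto simp: meets_shifted_def)

text \<open>
  The variables 0 to 3 hold the sets of points reachable with each of the four combinations of flags
  of a walk; positions are kept in variables from 4 on.
\<close>

definition flag_var :: "bool \<Rightarrow> bool \<Rightarrow> nat" where
  "flag_var a b = (if a then 2 else 0) + (if b then 1 else 0)"

definition walk_closed :: "formula \<Rightarrow> nat \<Rightarrow> nat \<Rightarrow> nat \<Rightarrow> nat \<Rightarrow> nat \<Rightarrow> nat \<Rightarrow> formula" where
  "walk_closed G l r lo y z hi =
    Forall_pos lo (Forall_pos y (Forall_pos z (Forall_pos hi
      (Impl (Conj G (Conj (Neg (Before lo l)) (Neg (Before r hi))))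
        (Forall_bool (\<lambda>a. Forall_bool (\<lambda>b. Forall_bool (\<lambda>c. Forall_bool (\<lambda>d.
          Impl (Conj (Meets y (flag_var a b))
              (Conj (Holds_iff c (Meets lo l)) (Holds_iff d (Meets hi r))))
            (Meets z (flag_var (a \<or> c) (b \<or> d))))))))))))"

text \<open>
  Reachability, as membership in all quadruples of sets that contain the start and are closed under
  the steps. The variables \<open>lo\<close>, \<open>y\<close>, \<open>z\<close>, \<open>hi\<close> are bound; the formula \<open>G\<close> for the steps may use \<open>l\<close>
  and \<open>r\<close> as well.
\<close>

definition walk_formula :: "formula \<Rightarrow> nat \<Rightarrow> nat \<Rightarrow> nat \<Rightarrow> nat \<Rightarrow> nat \<Rightarrow> nat \<Rightarrow> nat \<Rightarrow> nat \<Rightarrow> formula" where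
  "walk_formula G l s e r lo y z hi =
    Forall 0 (Forall 1 (Forall 2 (Forall 3
      (Impl (Conj (Meets s (flag_var False False)) (walk_closed G l r lo y z hi))
        (Meets e (flag_var True True))))))"

lemma flag_var_neq: "4 \<le> i \<Longrightarrow> flag_var a b \<noteq> i"
  by (simp add: flag_var_def)

lemma holds_walk_closed:
  assumes names: "distinct [l, r, lo, y, z, hi]" "\<forall>i\<in>{l, r, lo, y, z, hi}. 4 \<le> i"
    and V: "V l = {l0}" "V r = {r0}" "\<And>a b. V (flag_var a b) = Q a b"
    and G: "\<And>V a b c d. V l = {l0} \<Longrightarrow> V r = {r0} \<Longrightarrow> V lo = {a} \<Longrightarrow> V y = {b} \<Longrightarrow> V z = {c} \<Longrightarrow>
      V hi = {d} \<Longrightarrow> a < n \<Longrightarrow> b < n \<Longrightarrow> c < n \<Longrightarrow> d < n \<Longrightarrow> holds T n G V = R a b c d"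
  shows "holds T n (walk_closed G l r lo y z hi) V \<longleftrightarrow>
    (\<forall>p<n. \<forall>y<n. \<forall>z<n. \<forall>q<n. R p y z q \<and> l0 \<le> p \<and> q \<le> r0 \<longrightarrow>
      (\<forall>a b. y \<in> Q a b \<longrightarrow> z \<in> Q (a \<or> p = l0) (b \<or> q = r0)))"
proof -
  have neq: "flag_var a b \<noteq> i" if "i \<in> {l, r, lo, y, z, hi}" for a b i
    using names(2) that flag_var_neq by blast
  have "holds T n G (V(lo := {p}, y := {y'}, z := {z'}, hi := {q})) = R p y' z' q"
    if "p < n" "y' < n" "z' < n" "q < n" for p y' z' q
    by (rule G) (use names V that in auto)
  then show ?thesis
    using names(1) neq V unfolding walk_closed_def
    by (simp add: not_less del: all_simps) 
qed

lemma holds_walk_formula: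
  assumes names: "distinct [l, s, e, r, lo, y, z, hi]" "\<forall>i\<in>{l, s, e, r, lo, y, z, hi}. 4 \<le> i"
    and V: "V l = {l0}" "V s = {s0}" "V e = {e0}" "V r = {r0}" and less: "s0 < n" "r0 < n"
    and G: "\<And>V a b c d. V l = {l0} \<Longrightarrow> V r = {r0} \<Longrightarrow> V lo = {a} \<Longrightarrow> V y = {b} \<Longrightarrow> V z = {c} \<Longrightarrow>
      V hi = {d} \<Longrightarrow> a < n \<Longrightarrow> b < n \<Longrightarrow> c < n \<Longrightarrow> d < n \<Longrightarrow> holds T n G V = R a b c d"
    and R: "\<And>a b c d. R a b c d \<Longrightarrow> a \<le> d \<and> b \<le> d \<and> c \<le> d"
  shows "holds T n (walk_formula G l s e r lo y z hi) V \<longleftrightarrow> walk R l0 r0 s0 True True e0"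
proof -
  define closed where "closed = (\<lambda>Q. \<forall>p y z q a b. R p y z q \<longrightarrow> l0 \<le> p \<longrightarrow> q \<le> r0 \<longrightarrow> y \<in> Q a b \<longrightarrow>
      z \<in> Q (a \<or> p = l0) (b \<or> q = r0))"
  define env where "env = (\<lambda>Q. V(0 := Q False False, 1 := Q False True, 2 := Q True False, 3 := Q True True))"
  have env: "env Q (flag_var a b) = Q a b" for Q a b
    by (auto simp: env_def flag_var_def)
  have env_other: "env Q i = V i" if "4 \<le> i" for Q i
    using that by (auto simp: env_def)
  have "holds T n (walk_closed G l r lo y z hi) (env Q) \<longleftrightarrow> closed Q" for Q
  proof -
    have "holds T n (walk_closed G l r lo y z hi) (env Q) \<longleftrightarrow>
        (\<forall>p<n. \<forall>y<n. \<forall>z<n. \<forall>q<n. R p y z q \<and> l0 \<le> p \<and> q \<le> r0 \<longrightarrow>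
        (\<forall>a b. y \<in> Q a b \<longrightarrow> z \<in> Q (a \<or> p = l0) (b \<or> q = r0)))"
    proof (rule holds_walk_closed)
      show "holds T n G V' = R a b c d"
        if "V' l = {l0}" "V' r = {r0}" "V' lo = {a}" "V' y = {b}" "V' z = {c}" "V' hi = {d}"
          "a < n" "b < n" "c < n" "d < n" for V' a b c d
        using that by (rule G)
    qed (use names V env in \<open>simp_all add: env_other\<close>)
    also have "\<dots> \<longleftrightarrow> closed Q"
    proof -
      have "p < n \<and> y < n \<and> z < n \<and> q < n" if "R p y z q" "q \<le> r0" for p y z q
        using R[OF that(1)] that(2) less(2) by linarith
      note bounds = this
      show ?thesis (is "?L \<longleftrightarrow> _")
      proof
        assume L: ?L
        show "closed Q"
          unfolding closed_def
        proof (intro allI impI)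
          fix p y z q a b assume "R p y z q" "l0 \<le> p" "q \<le> r0" "y \<in> Q a b"
          with L[rule_format, of p y z q a b] bounds[of p y z q]
          show "z \<in> Q (a \<or> p = l0) (b \<or> q = r0)" by blast
        qed
      qed (auto simp: closed_def)
    qed
    finally show ?thesis .
  qed
  moreover have "holds T n (Meets s (flag_var False False)) (env Q) \<longleftrightarrow> s0 \<in> Q False False"
    "holds T n (Meets e (flag_var True True)) (env Q) \<longleftrightarrow> e0 \<in> Q True True" for Q
    using names V by (simp_all add: env env_other)
  moreover have "holds T n (walk_formula G l s e r lo y z hi) V \<longleftrightarrow>
      (\<forall>Q. (\<forall>a b. Q a b \<subseteq> {..<n}) \<longrightarrow> holds T n (Impl (Conj (Meets s (flag_var False False))
        (walk_closed G l r lo y z hi)) (Meets e (flag_var True True))) (env Q))"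
    (is "_ \<longleftrightarrow> (\<forall>Q. _ \<longrightarrow> ?B Q)")
  proof
    assume holds: "holds T n (walk_formula G l s e r lo y z hi) V"
    show "\<forall>Q. (\<forall>a b. Q a b \<subseteq> {..<n}) \<longrightarrow> ?B Q"
    proof (intro allI impI)
      fix Q :: "bool \<Rightarrow> bool \<Rightarrow> nat set" assume Q: "\<forall>a b. Q a b \<subseteq> {..<n}"
      show "?B Q"
        unfolding env_def
        by (rule holds[unfolded walk_formula_def holds_Forall, rule_format]) (use Q in blast)+
    qed
  next
    assume B: "\<forall>Q. (\<forall>a b. Q a b \<subseteq> {..<n}) \<longrightarrow> ?B Q"
    show "holds T n (walk_formula G l s e r lo y z hi) V"
      unfolding walk_formula_def holds_Forall
    proof (intro allI impI)
      fix W0 W1 W2 W3 assume W: "W0 \<subseteq> {..<n}" "W1 \<subseteq> {..<n}" "W2 \<subseteq> {..<n}" "W3 \<subseteq> {..<n}"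
      \<comment> \<open>The four sets correspond to one family indexed by the flags.\<close>
      define Q where "Q = (\<lambda>a b. if a then if b then W3 else W2 else if b then W1 else W0)"
      have "?B Q" using B W by (simp add: Q_def)
      moreover have "env Q = V(0 := W0, 1 := W1, 2 := W2, 3 := W3)"
        by (simp add: env_def Q_def)
      ultimately show "holds T n (Impl (Conj (Meets s (flag_var False False))
        (walk_closed G l r lo y z hi)) (Meets e (flag_var True True))) (V(0 := W0, 1 := W1, 2 := W2, 3 := W3))"
        by simp
    qed
  qed
  ultimately have *: "holds T n (walk_formula G l s e r lo y z hi) V \<longleftrightarrow>
      (\<forall>Q. (\<forall>a b. Q a b \<subseteq> {..<n}) \<longrightarrow> s0 \<in> Q False False \<and> closed Q \<longrightarrow> e0 \<in> Q True True)"
    by simp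
  show ?thesis
  proof
    let ?Q = "\<lambda>a b. {y. y < n \<and> walk R l0 r0 s0 a b y}"
    assume "holds T n (walk_formula G l s e r lo y z hi) V"
    moreover have "closed ?Q"
    proof -
      have "z < n" if "R p y z q" "q \<le> r0" for p y z q
        using R[OF that(1)] that(2) less(2) by linarith
      then show ?thesis
        unfolding closed_def by (auto intro: walk.step)
    qed
    ultimately show "walk R l0 r0 s0 True True e0"
      using less(1) walk.start[of R l0 r0 s0] unfolding * by (auto dest!: spec[of _ ?Q])
  next
    assume walk: "walk R l0 r0 s0 True True e0"
    have "y \<in> Q a b" if "walk R l0 r0 s0 a b y" "s0 \<in> Q False False" "closed Q" for Q a b y
      using that(1)
    proof induction
      case start then show ?case using that(2) .
    next
      case (step a b y lo z hi)
      then show ?case using that(3) unfolding closed_def by blast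
    qed
    then show "holds T n (walk_formula G l s e r lo y z hi) V"
      unfolding * using walk by blast
  qed
qed

definition both_formula :: "nat \<Rightarrow> nat \<Rightarrow> nat \<Rightarrow> nat \<Rightarrow> nat \<Rightarrow> nat \<Rightarrow> nat \<Rightarrow> nat \<Rightarrow> formula" where
  "both_formula l s e r lo y z hi =
    Conj (walk_formula (Arrow True lo y z hi) l s e r lo y z hi)
      (walk_formula (Arrow False lo y z hi) l s e r lo y z hi)"

text \<open>
  Variables 4 and 7 hold the two ends of the chain. The inner walk formula binds variables 8 to 11 for its
  steps, which must be elements of both subsemigroups other than those filling the whole chain. To
  describe such a step, variables 4 to 7 can be bound again.
\<close>

definition critical_formula :: formula where
  "critical_formula = Exists_pos 4 (Exists_pos 5 (Exists_pos 6 (Exists_pos 7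
    (Conj (Conj (Forall_pos 8 (Neg (Before 8 4))) (Forall_pos 8 (Neg (Before 7 8))))
      (Conj (both_formula 4 5 6 7 8 9 10 11)
        (Neg (walk_formula (Conj (both_formula 8 9 10 11 4 5 6 7)
            (Neg (Conj (Meets 8 4) (Meets 11 7)))) 4 5 6 7 8 9 10 11)))))))"

lemma holds_both_formula:
  assumes T: "\<And>b. T b = shape ` (if b then X else Y)"
    and names: "distinct [l, s, e, r, lo, y, z, hi]" "\<forall>i\<in>{l, s, e, r, lo, y, z, hi}. 4 \<le> i"
    and V: "V l = {l0}" "V s = {s0}" "V e = {e0}" "V r = {r0}" and less: "s0 < n" "r0 < n"
  shows "holds T n (both_formula l s e r lo y z hi) V \<longleftrightarrow>
    arrows (subsemigroup hull X \<inter> subsemigroup hull Y) l0 s0 e0 r0"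
proof -
  have "holds T n (walk_formula (Arrow b lo y z hi) l s e r lo y z hi) V \<longleftrightarrow>
      arrows (subsemigroup hull (if b then X else Y)) l0 s0 e0 r0" for b
    unfolding arrows_hull_iff_walk
  proof (rule holds_walk_formula[OF names V less])
    show "holds T n (Arrow b lo y z hi) V = arrows (if b then X else Y) p y' z' q"
      if "V lo = {p}" "V y = {y'}" "V z = {z'}" "V hi = {q}" for V p y' z' q
      using that unfolding holds.simps T arrows_def placed_def
      by (auto simp: shape_def)
  qed (auto simp: arrows_def dest: placed_bounds)
  from this[of True] this[of False]
  have "holds T n (both_formula l s e r lo y z hi) V \<longleftrightarrow>
      arrows (subsemigroup hull X) l0 s0 e0 r0 \<and> arrows (subsemigroup hull Y) l0 s0 e0 r0"
    by (simp add: both_formula_def)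
  also have "\<dots> \<longleftrightarrow> arrows (subsemigroup hull X \<inter> subsemigroup hull Y) l0 s0 e0 r0"
  proof -
    have "u = v" if "placed u l0 s0 e0 r0" "placed v l0 s0 e0 r0" for u v
      using that by (intro injD[OF inj_shape]) (simp add: placed_def shape_def)
    then show ?thesis unfolding arrows_def by blast
  qed
  finally show ?thesis .
qed

lemma holds_critical_formula:
  assumes T: "\<And>b. T b = shape ` (if b then X else Y)"
  defines "U \<equiv> subsemigroup hull X \<inter> subsemigroup hull Y"
  shows "holds T n critical_formula V \<longleftrightarrow> (\<exists>w. n = Suc w \<and> critical U w)"
proof (cases n)
  case 0
  then show ?thesis by (simp add: critical_formula_def)
next
  case (Suc w)
  let ?R = "\<lambda>lo y z hi. arrows U lo y z hi \<and> \<not> (lo = 0 \<and> hi = w)"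
  let ?G = "Conj (both_formula 8 9 10 11 4 5 6 7) (Neg (Conj (Meets 8 4) (Meets 11 7)))"
  have both: "holds T n (both_formula 4 5 6 7 8 9 10 11) (V(4 := {0}, 5 := {s}, 6 := {e}, 7 := {w})) \<longleftrightarrow>
      arrows U 0 s e w" if "s < n" for s e
    unfolding U_def by (rule holds_both_formula[OF T]) (use that Suc in auto)
  have walk: "holds T n (walk_formula ?G 4 5 6 7 8 9 10 11) (V(4 := {0}, 5 := {s}, 6 := {e}, 7 := {w})) \<longleftrightarrow>
      walk ?R 0 w s True True e" if "s < n" for s e
  proof (rule holds_walk_formula)
    show "holds T n ?G V = ?R lo y z hi"
      if "V 4 = {0}" "V 7 = {w}" "V 8 = {lo}" "V 9 = {y}" "V 10 = {z}" "V 11 = {hi}" "y < n" "hi < n"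
      for V lo y z hi
      using holds_both_formula[OF T _ _ that(3-8), of 4 5 6 7] that by (simp add: U_def)
  qed (use that Suc in \<open>auto simp: arrows_def dest: placed_bounds\<close>)
  have ends: "(\<forall>x<n. \<not> x < p) \<longleftrightarrow> p = 0" "(\<forall>x<n. \<not> q < x) \<longleftrightarrow> q = w" if "p < n" "q < n" for p q
    using that Suc by (auto simp: not_less)
  have "holds T n critical_formula V \<longleftrightarrow> (\<exists>s<n. \<exists>e<n. arrows U 0 s e w \<and> \<not> walk ?R 0 w s True True e)"
  proof -
    have "holds T n critical_formula V \<longleftrightarrow> (\<exists>l<n. \<exists>s<n. \<exists>e<n. \<exists>r<n. (l = 0 \<and> r = w) \<and>
        holds T n (both_formula 4 5 6 7 8 9 10 11) (V(4 := {l}, 5 := {s}, 6 := {e}, 7 := {r})) \<and>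
        \<not> holds T n (walk_formula ?G 4 5 6 7 8 9 10 11) (V(4 := {l}, 5 := {s}, 6 := {e}, 7 := {r})))"
      unfolding critical_formula_def holds_Exists_pos holds.simps(4,5) holds_Forall_pos
      by (intro ex_cong1 conj_cong refl) (simp_all add: ends)
    also have "\<dots> \<longleftrightarrow> (\<exists>s<n. \<exists>e<n. arrows U 0 s e w \<and> \<not> walk ?R 0 w s True True e)"
    proof -
      have "(\<exists>l<n. \<exists>s<n. \<exists>e<n. \<exists>r<n. (l = 0 \<and> r = w) \<and> B l s e r) \<longleftrightarrow> (\<exists>s<n. \<exists>e<n. B 0 s e w)" for B
        using Suc by blast
      then show ?thesis by (simp only: both walk cong: conj_cong)
    qed
    finally show ?thesis .
  qed
  also have "\<dots> \<longleftrightarrow> critical U w"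
  proof -
    have "subsemigroup U"
      using subsemigroup_hull[of X] subsemigroup_hull[of Y] by (auto simp: U_def subsemigroup_def)
    moreover have "s < n \<and> e < n" if "arrows U 0 s e w" for s e
      using that Suc by (auto simp: arrows_def less_Suc_eq_le dest: placed_bounds)
    ultimately show ?thesis unfolding critical_iff_walk[OF \<open>subsemigroup U\<close>] by blast
  qed
  finally show ?thesis using Suc by simp
qed

lemma vars_below_critical_formula: "vars_below 12 critical_formula"
  by (simp add: critical_formula_def both_formula_def walk_formula_def walk_closed_def Impl_def
      Forall_def Exists_pos_def Forall_pos_def Forall_bool_def Holds_iff_def flag_var_def)

section \<open>Closure properties of the recursive functions\<close>

text \<open>
  Composition with projections gives access to an environment below its first entry.
\<close>

lemma recursive_weaken:
  assumes "recursive n f"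
  shows "recursive (Suc n) (\<lambda>ys. f (tl ys))"
proof -
  let ?gs = "map (\<lambda>i (ys::nat list). ys ! Suc i) [0..<n]"
  have "recursive (Suc n) (\<lambda>ys. f (map (\<lambda>g. g ys) ?gs))"
    by (rule recursive.comp) (use assms in \<open>auto intro!: recursive.proj\<close>)
  then show ?thesis
  proof (rule recursive.cong, intro allI impI)
    fix ys :: "nat list" assume "length ys = Suc n"
    then have "map (\<lambda>g. g ys) ?gs = tl ys"
      by (intro nth_equalityI) (auto simp: nth_tl)
    then show "f (map (\<lambda>g. g ys) ?gs) = f (tl ys)" by simp
  qed
qed

lemma recursive_comp_list:
  assumes "recursive m F" "length gs = m" "\<And>g. g \<in> set gs \<Longrightarrow> recursive n g"
  shows "recursive n (\<lambda>xs. F (map (\<lambda>g. g xs) gs))"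
  using assms by (auto intro!: recursive.comp)

lemma recursive_cons_comp:
  assumes F: "recursive (Suc n) F" and h: "recursive n h"
  shows "recursive n (\<lambda>xs. F (h xs # xs))"
proof -
  let ?gs = "h # map (\<lambda>i (xs::nat list). xs ! i) [0..<n]"
  have "recursive n (\<lambda>xs. F (map (\<lambda>g. g xs) ?gs))"
    by (rule recursive_comp_list[OF F]) (use h in \<open>auto intro!: recursive.proj\<close>)
  then show ?thesis
  proof (rule recursive.cong, intro allI impI)
    fix xs :: "nat list" assume "length xs = n"
    then have "map (\<lambda>g. g xs) (map (\<lambda>i xs. xs ! i) [0..<n]) = xs"
      by (intro nth_equalityI) auto
    then show "F (map (\<lambda>g. g xs) ?gs) = F (h xs # xs)" by simp
  qed
qed

lemma recursive_rec_nat: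
  assumes "recursive n f" "recursive (Suc (Suc n)) g" "recursive n h"
  shows "recursive n (\<lambda>xs. rec_nat (f xs) (\<lambda>k r. g (k # r # xs)) (h xs))"
  using recursive_cons_comp[OF recursive.prec[OF assms(1,2)] assms(3)] by simp

lemma recursive_Suc:
  assumes "recursive n f" shows "recursive n (\<lambda>xs. Suc (f xs))"
  using recursive_comp_list[OF recursive.succ, of "[f]" n] assms by simp

lemma recursive_const: "recursive n (\<lambda>_. c)"
  by (induction c) (auto intro: recursive.zero recursive_Suc)

lemma recursive_weaken2:
  "recursive n f \<Longrightarrow> recursive (Suc (Suc n)) (\<lambda>ys. f (tl (tl ys)))"
  using recursive_weaken[OF recursive_weaken] .

lemma recursive_add:
  assumes "recursive n f" "recursive n g" shows "recursive n (\<lambda>xs. f xs + g xs)"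
proof -
  have "rec_nat a (\<lambda>k r. Suc r) b = b + a" for a b by (induction b) auto
  then show ?thesis
    using recursive_rec_nat[OF assms(2) recursive_Suc[OF recursive.proj] assms(1), of 1] by simp
qed

lemma recursive_mult:
  assumes "recursive n f" "recursive n g" shows "recursive n (\<lambda>xs. f xs * g xs)"
proof -
  have "rec_nat 0 (\<lambda>k r. r + a) b = b * a" for a b :: nat by (induction b) auto
  then show ?thesis
    using recursive_rec_nat[OF recursive.zero
        recursive_add[OF recursive.proj recursive_weaken2[OF assms(2)]] assms(1), of 1]
    by simp
qed

lemma recursive_predecessor:
  assumes "recursive n f" shows "recursive n (\<lambda>xs. f xs - 1)"
proof -
  have "rec_nat 0 (\<lambda>k r. k) b = b - 1" for b :: nat by (cases b) auto
  then show ?thesis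
    using recursive_rec_nat[OF recursive.zero recursive.proj assms, of 0] by simp
qed

lemma recursive_diff:
  assumes "recursive n f" "recursive n g" shows "recursive n (\<lambda>xs. f xs - g xs)"
proof -
  have "rec_nat a (\<lambda>k r. r - 1) b = a - b" for a b :: nat by (induction b) auto
  then show ?thesis
    using recursive_rec_nat[OF assms(1) recursive_predecessor[OF recursive.proj] assms(2), of 1] by simp
qed

lemma recursive_power2:
  assumes "recursive n f" shows "recursive n (\<lambda>xs. 2 ^ f xs)"
proof -
  have "rec_nat 1 (\<lambda>k r. r + r) b = (2 ^ b :: nat)" for b by (induction b) auto
  then show ?thesis
    using recursive_rec_nat[OF recursive_const recursive_add[OF recursive.proj recursive.proj] assms,
        of 1 1 1] by simp
qed

lemma recursive_prod_encode:
  assumes "recursive n f" "recursive n g" shows "recursive n (\<lambda>xs. prod_encode (f xs, g xs))"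
proof -
  have "rec_nat 0 (\<lambda>k r. r + Suc k) b = triangle b" for b :: nat by (induction b) auto
  then have "recursive n (\<lambda>xs. triangle (f xs + g xs))"
    using recursive_rec_nat[OF recursive.zero
        recursive_add[OF recursive.proj recursive_Suc[OF recursive.proj]]
        recursive_add[OF assms], of 1 0] by simp
  then show ?thesis
    using recursive_add assms(1) by (simp add: prod_encode_def)
qed

definition recursive_predicate :: "nat \<Rightarrow> (nat list \<Rightarrow> bool) \<Rightarrow> bool" where
  "recursive_predicate n P \<longleftrightarrow> recursive n (\<lambda>xs. if P xs then 1 else 0)"

lemma recursive_predicate_Not:
  assumes "recursive_predicate n P" shows "recursive_predicate n (\<lambda>xs. \<not> P xs)"
proof -
  have "recursive n (\<lambda>xs. 1 - (if P xs then 1 else 0))"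
    using recursive_diff[OF recursive_const assms[unfolded recursive_predicate_def], of 1] .
  then show ?thesis unfolding recursive_predicate_def by (rule recursive.cong) auto
qed

lemma recursive_predicate_conj:
  assumes "recursive_predicate n P" "recursive_predicate n Q"
  shows "recursive_predicate n (\<lambda>xs. P xs \<and> Q xs)"
proof -
  have "recursive n (\<lambda>xs. (if P xs then 1 else 0) * (if Q xs then 1 else 0))"
    using recursive_mult assms unfolding recursive_predicate_def .
  then show ?thesis unfolding recursive_predicate_def by (rule recursive.cong) auto
qed

lemma recursive_predicate_le:
  assumes "recursive n f" "recursive n g"
  shows "recursive_predicate n (\<lambda>xs. f xs \<le> g xs)"
proof -
  have "recursive n (\<lambda>xs. 1 - (f xs - g xs))"
    using recursive_diff[OF recursive_const recursive_diff[OF assms], of 1] .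
  then show ?thesis unfolding recursive_predicate_def by (rule recursive.cong) auto
qed

lemma recursive_predicate_less:
  assumes "recursive n f" "recursive n g"
  shows "recursive_predicate n (\<lambda>xs. f xs < g xs)"
  using recursive_predicate_le[OF recursive_Suc[OF assms(1)] assms(2)] by (simp add: Suc_le_eq)

lemma recursive_predicate_eq:
  assumes "recursive n f" "recursive n g"
  shows "recursive_predicate n (\<lambda>xs. f xs = g xs)"
  using recursive_predicate_conj[OF recursive_predicate_le[OF assms] recursive_predicate_le[OF assms(2,1)]]
  by (simp add: eq_iff)

lemma recursive_if:
  assumes "recursive_predicate n P" "recursive n f" "recursive n g"
  shows "recursive n (\<lambda>xs. if P xs then f xs else g xs)"
proof -
  have "recursive n (\<lambda>xs. (if P xs then 1 else 0) * f xs + (1 - (if P xs then 1 else 0)) * g xs)"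
    by (intro recursive_add recursive_mult recursive_diff recursive_const assms(2,3)
        assms(1)[unfolded recursive_predicate_def])
  then show ?thesis by (rule recursive.cong) auto
qed

lemma recursive_predicate_comp:
  assumes "recursive_predicate m P" "length gs = m" "\<And>g. g \<in> set gs \<Longrightarrow> recursive n g"
  shows "recursive_predicate n (\<lambda>xs. P (map (\<lambda>g. g xs) gs))"
  using recursive_comp_list[OF assms[unfolded recursive_predicate_def]]
  unfolding recursive_predicate_def by simp

text \<open>
  The bounded quantifier adds its variable at the head of the environment.
\<close>

lemma recursive_predicate_bex:
  assumes P: "recursive_predicate m P" and m: "m = Suc n" and b: "recursive n b"
  shows "recursive_predicate n (\<lambda>xs. \<exists>k<b xs. P (k # xs))"
proof -
  let ?gs = "(\<lambda>ys. ys ! 0) # map (\<lambda>i (ys::nat list). ys ! Suc (Suc i)) [0..<n]"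
  have "recursive_predicate (Suc (Suc n)) (\<lambda>ys. P (map (\<lambda>g. g ys) ?gs))"
    by (rule recursive_predicate_comp[OF P[unfolded m]]) (auto intro!: recursive.proj)
  then have "recursive (Suc (Suc n)) (\<lambda>ys. if P (map (\<lambda>g. g ys) ?gs) then 1 else ys ! 1)"
    by (intro recursive_if recursive_const recursive.proj) auto
  from recursive_rec_nat[OF recursive.zero this b]
  show ?thesis
    unfolding recursive_predicate_def
  proof (rule recursive.cong, intro allI impI)
    fix xs :: "nat list" assume "length xs = n"
    then have map: "map (\<lambda>g. g (k # r # xs)) ?gs = k # xs" for k r
      by (intro nth_equalityI) (auto simp: nth_Cons split: nat.splits)
    have "rec_nat 0 (\<lambda>k r. if P (k # xs) then 1 else r) c = (if \<exists>k<c. P (k # xs) then 1 else 0)"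
      for c by (induction c) (auto simp: less_Suc_eq)
    moreover have "(k # r # xs) ! 1 = r" for k r by simp
    ultimately show "rec_nat 0 (\<lambda>k r. if P (map (\<lambda>g. g (k # r # xs)) ?gs) then 1 else (k # r # xs) ! 1)
        (b xs) = (if \<exists>k<b xs. P (k # xs) then 1 else 0)"
      by (simp only: map)
  qed
qed

lemmas recursive_intros = recursive_Suc recursive_const recursive_add recursive_mult recursive_diff
  recursive_power2 recursive_prod_encode recursive_if recursive_predicate_Not recursive_predicate_conj
  recursive_predicate_le recursive_predicate_less recursive_predicate_eq recursive.proj

text \<open>
  Membership in a coded set is a digit of the binary expansion. This form of it uses only bounded
  quantifiers, sums, products and powers of two.
\<close>

lemma mem_set_decode_iff:
  "c \<in> set_decode q \<longleftrightarrow> (\<exists>a<Suc q. \<exists>r<2 ^ c. q = (2 * a + 1) * 2 ^ c + r)"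
proof
  assume "c \<in> set_decode q"
  then have odd: "odd (q div 2 ^ c)" by (simp add: set_decode_def)
  then obtain a where a: "q div 2 ^ c = 2 * a + 1" by (elim oddE)
  have q: "q = (2 * a + 1) * 2 ^ c + q mod 2 ^ c"
    unfolding a[symmetric] by (rule div_mult_mod_eq[symmetric])
  have "a \<le> (2 * a + 1) * 2 ^ c" using one_le_power[of 2 c]
    by (metis add_leE le_add2 mult.commute mult_le_mono1 mult_numeral_1 mult_2 nat_mult_1 order_trans numeral_One one_le_numeral le_add1)
  then have "a < Suc q" using q by linarith
  then show "\<exists>a<Suc q. \<exists>r<2 ^ c. q = (2 * a + 1) * 2 ^ c + r"
    using q by (intro exI[of _ a] conjI exI[of _ "q mod 2 ^ c"]) auto
next
  assume "\<exists>a<Suc q. \<exists>r<2 ^ c. q = (2 * a + 1) * 2 ^ c + r"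
  then obtain a r where "r < 2 ^ c" "q = (2 * a + 1) * 2 ^ c + r" by blast
  then have "q div 2 ^ c = 2 * a + 1" by (intro div_nat_eqI) (auto simp: algebra_simps)
  then show "c \<in> set_decode q" by (simp add: set_decode_def)
qed

lemma recursive_predicate_mem_set_decode:
  assumes "recursive n f" "recursive n g"
  shows "recursive_predicate n (\<lambda>xs. f xs \<in> set_decode (g xs))"
proof -
  have "recursive_predicate 2 (\<lambda>xs. xs ! 0 \<in> set_decode (xs ! 1))"
  proof -
    have "recursive_predicate 4 (\<lambda>ys. ys ! 3 = (2 * ys ! 1 + 1) * 2 ^ (ys ! 2) + ys ! 0)"
      by (intro recursive_intros) auto
    from recursive_predicate_bex[OF this, where n = 3 and b = "\<lambda>ys. 2 ^ (ys ! 1)"]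
    have "recursive_predicate 3 (\<lambda>ys. \<exists>r<2 ^ (ys ! 1). ys ! 2 = (2 * ys ! 0 + 1) * 2 ^ (ys ! 1) + r)"
      by (simp add: recursive_intros del: mult_Suc add_mult_distrib)
    from recursive_predicate_bex[OF this, where n = 2 and b = "\<lambda>xs. Suc (xs ! 1)"]
    show ?thesis
      unfolding mem_set_decode_iff by (simp add: recursive_intros)
  qed
  from recursive_predicate_comp[OF this, of "[f, g]"] assms show ?thesis by auto
qed

lemma mem_set_decode_less:
  assumes "x \<in> set_decode q" shows "x < q"
proof -
  have "\<not> q < 2 ^ x"
    using assms by (auto simp: set_decode_def)
  then show ?thesis using less_exp[of x] by linarith
qed

section \<open>Codes of generating sets\<close>

text \<open>
  The code of an element in terms of its shape, free of integers: \<open>int_encode\<close> sends \<open>i \<ge> 0\<close> to \<open>2 i\<close>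
  and \<open>- i < 0\<close> to \<open>2 i - 1\<close>, and truncated subtraction gives the right value \<open>0\<close> at \<open>i = 0\<close>.
\<close>

definition shape_encode :: "nat \<Rightarrow> nat \<Rightarrow> nat \<Rightarrow> nat" where
  "shape_encode s e w = prod_encode (2 * s - 1,
     prod_encode (if s \<le> e then 2 * (e - s) else 2 * (s - e) - 1, 2 * (w - s)))"

definition shapes :: "nat \<Rightarrow> (nat \<times> nat \<times> nat) set" where
  "shapes q = {(s, e, w). s \<le> w \<and> e \<le> w \<and> 0 < w \<and> shape_encode s e w \<in> set_decode q}"

lemma fi1_encode_eq: "fi1_encode u = shape_encode (start_of u) (end_of u) (width u)"
proof -
  have "int_encode (- int s) = 2 * s - 1" for s
    by (cases s) (auto simp: int_encode_def sum_encode_def nat_diff_distrib')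
  moreover have "int_encode (int e - int s) = (if s \<le> e then 2 * (e - s) else 2 * (s - e) - 1)" for e s
    by (auto simp: int_encode_def sum_encode_def nat_diff_distrib)
  moreover have "int_encode (int e - int s) = 2 * (e - s)" if "s \<le> e" for e s
    using that by (auto simp: int_encode_def sum_encode_def nat_diff_distrib)
  ultimately show ?thesis
    by (simp add: fi1_encode_def Rep_fi1_shape shape_encode_def)
qed

lemma shapes_set_encode:
  assumes "finite X"
  shows "shapes (set_encode (fi1_encode ` X)) = shape ` X"
proof -
  have "(s, e, w) \<in> shapes (set_encode (fi1_encode ` X)) \<longleftrightarrow> (s, e, w) \<in> shape ` X" for s e w
  proof
    assume *: "(s, e, w) \<in> shapes (set_encode (fi1_encode ` X))"
    then obtain u where u: "shape u = (s, e, w)" using ex_shape[of s w e] by (auto simp: shapes_def)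
    then have "fi1_encode u \<in> fi1_encode ` X"
      using * assms by (auto simp: shapes_def fi1_encode_eq shape_def)
    then show "(s, e, w) \<in> shape ` X"
      using u inj_fi1_encode by (metis image_eqI inj_image_mem_iff)
  next
    assume "(s, e, w) \<in> shape ` X"
    then show "(s, e, w) \<in> shapes (set_encode (fi1_encode ` X))"
      using assms Rep_fi1_shape(2-4) by (auto simp: shapes_def shape_def simp flip: fi1_encode_eq)
  qed
  then show ?thesis by auto
qed

lemma shapes_bounded:
  assumes "(s, e, w) \<in> shapes q"
  shows "s \<le> q" "e \<le> q" "w \<le> q"
proof -
  have "shape_encode s e w < q" "s \<le> w" "e \<le> w"
    using assms mem_set_decode_less by (auto simp: shapes_def)
  moreover have "2 * s - 1 \<le> shape_encode s e w" "2 * (w - s) \<le> shape_encode s e w"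
    unfolding shape_encode_def
    by (rule le_prod_encode_1, rule order_trans[OF le_prod_encode_2 le_prod_encode_2])
  ultimately show "s \<le> q" "e \<le> q" "w \<le> q" by linarith+
qed

section \<open>Truth in a chain is recursive\<close>

lemma recursive_predicate_meets_shifted:
  assumes "recursive n c" "recursive n f" "recursive n g"
  shows "recursive_predicate n (\<lambda>xs. meets_shifted (c xs) (set_decode (f xs)) (set_decode (g xs)))"
proof -
  have "recursive_predicate 4 (\<lambda>ys. ys ! 0 \<in> set_decode (ys ! 2) \<and> ys ! 0 + ys ! 1 \<in> set_decode (ys ! 3))"
    by (intro recursive_intros recursive_predicate_mem_set_decode) auto
  from recursive_predicate_bex[OF this, where n = 3 and b = "\<lambda>xs. xs ! 1"]
  have "recursive_predicate 3 (\<lambda>xs. \<exists>x<xs ! 1. x \<in> set_decode (xs ! 1) \<and> x + xs ! 0 \<in> set_decode (xs ! 2))"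
    by (simp add: recursive_intros)
  from recursive_predicate_comp[OF this, of "[c, f, g]" n] assms
  have "recursive_predicate n (\<lambda>xs. \<exists>x<f xs. x \<in> set_decode (f xs) \<and> x + c xs \<in> set_decode (g xs))"
    by auto
  moreover have "(\<exists>x<q. x \<in> set_decode q \<and> P x) \<longleftrightarrow> (\<exists>x\<in>set_decode q. P x)" for q P
    using mem_set_decode_less by blast
  ultimately show ?thesis by (simp add: meets_shifted_def)
qed

lemma recursive_predicate_before:
  assumes "recursive n f" "recursive n g"
  shows "recursive_predicate n (\<lambda>xs. \<exists>x\<in>set_decode (f xs). \<exists>y\<in>set_decode (g xs). x < y)"
proof -
  have "recursive_predicate 4 (\<lambda>ys. ys ! 1 \<in> set_decode (ys ! 2) \<and> ys ! 0 \<in> set_decode (ys ! 3) \<and> ys ! 1 < ys ! 0)"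
    by (intro recursive_intros recursive_predicate_mem_set_decode) auto
  from recursive_predicate_bex[OF this, where n = 3 and b = "\<lambda>xs. xs ! 2"]
  have "recursive_predicate 3 (\<lambda>xs. \<exists>y<xs ! 2. xs ! 0 \<in> set_decode (xs ! 1) \<and>
      y \<in> set_decode (xs ! 2) \<and> xs ! 0 < y)"
    by (simp add: recursive_intros)
  from recursive_predicate_bex[OF this, where n = 2 and b = "\<lambda>xs. xs ! 0"]
  have "recursive_predicate 2 (\<lambda>xs. \<exists>x<xs ! 0. \<exists>y<xs ! 1. x \<in> set_decode (xs ! 0) \<and>
      y \<in> set_decode (xs ! 1) \<and> x < y)"
    by (simp add: recursive_intros)
  from recursive_predicate_comp[OF this, of "[f, g]" n] assms
  have "recursive_predicate n (\<lambda>xs. \<exists>x<f xs. \<exists>y<g xs. x \<in> set_decode (f xs) \<and>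
      y \<in> set_decode (g xs) \<and> x < y)"
    by auto
  moreover have "(\<exists>x<p. \<exists>y<q. x \<in> set_decode p \<and> y \<in> set_decode q \<and> x < y) \<longleftrightarrow>
      (\<exists>x\<in>set_decode p. \<exists>y\<in>set_decode q. x < y)" for p q
    using mem_set_decode_less by blast
  ultimately show ?thesis by simp
qed

lemma recursive_predicate_arrow:
  assumes "recursive n q" "recursive n f" "recursive n g" "recursive n h" "recursive n d"
  shows "recursive_predicate n (\<lambda>xs. \<exists>(s, e, w)\<in>shapes (q xs).
    meets_shifted s (set_decode (f xs)) (set_decode (g xs)) \<and>
    meets_shifted e (set_decode (f xs)) (set_decode (h xs)) \<and>
    meets_shifted w (set_decode (f xs)) (set_decode (d xs)))"
proof -
  let ?B = "\<lambda>e s w q f g h d. s \<le> w \<and> e \<le> w \<and> 0 < w \<and> shape_encode s e w \<in> set_decode q \<and>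
    meets_shifted s (set_decode f) (set_decode g) \<and>
    meets_shifted e (set_decode f) (set_decode h) \<and>
    meets_shifted w (set_decode f) (set_decode d)"
  have "recursive_predicate 8 (\<lambda>ys. ?B (ys ! 0) (ys ! 1) (ys ! 2) (ys ! 3) (ys ! 4) (ys ! 5) (ys ! 6) (ys ! 7))"
    unfolding shape_encode_def
    by (intro recursive_intros recursive_predicate_mem_set_decode recursive_predicate_meets_shifted) auto
  from recursive_predicate_bex[OF this, where n = 7 and b = "\<lambda>ys. Suc (ys ! 2)"]
  have "recursive_predicate 7 (\<lambda>ys. \<exists>e<Suc (ys ! 2).
      ?B e (ys ! 0) (ys ! 1) (ys ! 2) (ys ! 3) (ys ! 4) (ys ! 5) (ys ! 6))"
    by (simp add: recursive_intros)
  from recursive_predicate_bex[OF this, where n = 6 and b = "\<lambda>ys. Suc (ys ! 1)"]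
  have "recursive_predicate 6 (\<lambda>ys. \<exists>s<Suc (ys ! 1). \<exists>e<Suc (ys ! 1).
      ?B e s (ys ! 0) (ys ! 1) (ys ! 2) (ys ! 3) (ys ! 4) (ys ! 5))"
    by (simp add: recursive_intros)
  from recursive_predicate_bex[OF this, where n = 5 and b = "\<lambda>ys. Suc (ys ! 0)"]
  have "recursive_predicate 5 (\<lambda>ys. \<exists>w<Suc (ys ! 0). \<exists>s<Suc (ys ! 0). \<exists>e<Suc (ys ! 0).
      ?B e s w (ys ! 0) (ys ! 1) (ys ! 2) (ys ! 3) (ys ! 4))"
    by (simp add: recursive_intros)
  from recursive_predicate_comp[OF this, of "[q, f, g, h, d]" n] assms
  have "recursive_predicate n (\<lambda>xs. \<exists>w<Suc (q xs). \<exists>s<Suc (q xs). \<exists>e<Suc (q xs).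
      ?B e s w (q xs) (f xs) (g xs) (h xs) (d xs))"
    by auto
  moreover have "(\<exists>w<Suc q. \<exists>s<Suc q. \<exists>e<Suc q. ?B e s w q f g h d) \<longleftrightarrow>
      (\<exists>(s, e, w)\<in>shapes q. meets_shifted s (set_decode f) (set_decode g) \<and>
        meets_shifted e (set_decode f) (set_decode h) \<and>
        meets_shifted w (set_decode f) (set_decode d))" for q f g h d
  proof -
    have "(\<exists>w<Suc q. \<exists>s<Suc q. \<exists>e<Suc q. (s, e, w) \<in> shapes q \<and> P s e w) \<longleftrightarrow>
        (\<exists>(s, e, w)\<in>shapes q. P s e w)" for P
      using shapes_bounded[of _ _ _ q] unfolding less_Suc_eq_le by blast
    then show ?thesis by (simp add: shapes_def conj_assoc)
  qed
  ultimately show ?thesis by simp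
qed

text \<open>
  Variables of formulas are named, so a quantifier overwrites an entry of the environment.
\<close>

lemma recursive_predicate_update_bex:
  assumes P: "recursive_predicate n P" and i: "i < n" and b: "recursive n b"
  shows "recursive_predicate n (\<lambda>xs. \<exists>k<b xs. P (xs[i := k]))"
proof -
  let ?gs = "(map (\<lambda>j (ys::nat list). ys ! Suc j) [0..<n])[i := \<lambda>ys. ys ! 0]"
  have "recursive (Suc n) g" if "g \<in> set ?gs" for g
    using subsetD[OF set_update_subset_insert that] by (auto intro!: recursive.proj)
  then have "recursive_predicate (Suc n) (\<lambda>ys. P (map (\<lambda>g. g ys) ?gs))"
    by (intro recursive_predicate_comp[OF P]) auto
  from recursive_predicate_bex[OF this refl b]
  show ?thesis
    unfolding recursive_predicate_def
  proof (rule recursive.cong, intro allI impI)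
    fix xs :: "nat list" assume "length xs = n"
    then have "map (\<lambda>g. g (k # xs)) ?gs = xs[i := k]" for k
      using i by (intro nth_equalityI) (auto simp: nth_list_update)
    then show "(if \<exists>k<b xs. P (map (\<lambda>g. g (k # xs)) ?gs) then 1 else 0) =
        (if \<exists>k<b xs. P (xs[i := k]) then 1 else 0 :: nat)"
      by simp
  qed
qed

lemma ex_subset_iff_ex_less: "(\<exists>W\<subseteq>{..<n}. P W) \<longleftrightarrow> (\<exists>k<2 ^ n. P (set_decode k))"
proof
  assume "\<exists>W\<subseteq>{..<n}. P W"
  then obtain W where W: "W \<subseteq> {..<n}" "P W" by blast
  then have "finite W" by (rule_tac finite_subset) auto
  then show "\<exists>k<2 ^ n. P (set_decode k)"
    using W set_encode_less[OF W(1)] by (intro exI[of _ "set_encode W"]) simp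
next
  assume "\<exists>k<2 ^ n. P (set_decode k)"
  then obtain k where k: "k < 2 ^ n" "P (set_decode k)" by blast
  have "x < n" if "x \<in> set_decode k" for x
  proof (rule ccontr)
    assume "\<not> x < n"
    then have "k < 2 ^ x" using k(1) by (meson less_le_trans not_less one_le_numeral power_increasing)
    then show False using that by (simp add: set_decode_def)
  qed
  then show "\<exists>W\<subseteq>{..<n}. P W" using k by (intro exI[of _ "set_decode k"]) auto
qed

lemma holds_cong_vars:
  assumes "vars_below m F" "\<And>i. i < m \<Longrightarrow> V i = V' i"
  shows "holds T n F V = holds T n F V'"
  using assms
proof (induction F arbitrary: V V')
  case (Exists i F)
  have "holds T n F (V(i := W)) = holds T n F (V'(i := W))" for W
    by (rule Exists.IH) (use Exists.prems in simp_all)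
  then show ?case by simp
next
  case (Conj F G)
  have "holds T n F V = holds T n F V'" "holds T n G V = holds T n G V'"
    by (rule Conj.IH; use Conj.prems in simp)+
  then show ?case by simp
next
  case (Neg F)
  have "holds T n F V = holds T n F V'"
    by (rule Neg.IH) (use Neg.prems in simp_all)
  then show ?case by simp
qed auto

text \<open>
  The environment consists of the codes of the two sets of shapes, the length of the chain and the
  codes of the values of the variables. A subset of \<open>{..<n}\<close> has a code below \<open>2 ^ n\<close>, so set
  quantifiers are bounded.
\<close>

lemma recursive_holds:
  assumes "vars_below m F"
  shows "recursive_predicate (m + 3) (\<lambda>xs. holds (\<lambda>b. shapes (if b then xs ! 0 else xs ! 1)) (xs ! 2) F
    (\<lambda>i. set_decode (xs ! (i + 3))))"
  using assms
proof (induction F)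
  case (Meets i j)
  then show ?case
    by (simp only: holds.simps) (intro recursive_predicate_meets_shifted recursive_intros; simp)
next
  case (Before i j)
  then show ?case
    by (simp only: holds.simps) (intro recursive_predicate_before recursive_intros; simp)
next
  case (Arrow b i j k h)
  then show ?case
    by (cases b; simp only: holds.simps if_True if_False)
      (intro recursive_predicate_arrow recursive.proj; simp)+
next
  case (Neg F)
  then show ?case by (simp add: recursive_predicate_Not)
next
  case (Conj F G)
  then show ?case by (simp add: recursive_predicate_conj)
next
  case (Exists i F)
  then have i: "i < m" by simp
  have "recursive_predicate (m + 3) (\<lambda>xs. \<exists>k<2 ^ (xs ! 2).
      holds (\<lambda>b. shapes (if b then xs[i + 3 := k] ! 0 else xs[i + 3 := k] ! 1)) (xs[i + 3 := k] ! 2) F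
        (\<lambda>j. set_decode (xs[i + 3 := k] ! (j + 3))))"
    using Exists i by (intro recursive_predicate_update_bex recursive_intros) auto
  then show ?case
    unfolding recursive_predicate_def
  proof (rule recursive.cong, intro allI impI)
    fix xs :: "nat list" assume "length xs = m + 3"
    then have "(\<lambda>j. set_decode (xs[i + 3 := k] ! (j + 3))) =
        (\<lambda>j. set_decode (xs ! (j + 3)))(i := set_decode k)" for k
      using i by (auto simp: fun_eq_iff nth_list_update)
    then show "(if \<exists>k<2 ^ (xs ! 2).
        holds (\<lambda>b. shapes (if b then xs[i + 3 := k] ! 0 else xs[i + 3 := k] ! 1)) (xs[i + 3 := k] ! 2) F
          (\<lambda>j. set_decode (xs[i + 3 := k] ! (j + 3))) then 1 else 0) =
      (if holds (\<lambda>b. shapes (if b then xs ! 0 else xs ! 1)) (xs ! 2) (Exists i F)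
        (\<lambda>i. set_decode (xs ! (i + 3))) then 1 else 0 :: nat)"
      by (simp add: ex_subset_iff_ex_less cong: if_cong)
  qed
qed

lemma recursive_mso_type_bound:
  assumes "recursive n f" shows "recursive n (\<lambda>xs. mso_type_bound (f xs) m k)"
  by (induction k) (simp_all only: mso_type_bound.simps, (intro recursive_intros assms; assumption)+)

text \<open>
  The shapes coded by \<open>p\<close> and \<open>q\<close> are bounded by the code of the pair, which yields a recursive
  bound \<open>K\<close> on the number of types.
\<close>

lemma decidable_infinite_holds:
  assumes F: "vars_below m F"
  shows "\<exists>f. recursive 1 f \<and> (\<forall>p q. f [prod_encode (p, q)] =
    (if finite {n. holds (\<lambda>b. shapes (if b then p else q)) n F (\<lambda>_. {})} then 1 else 0))"
proof -
  define E where "E = (\<lambda>p q n. holds (\<lambda>b. shapes (if b then p else q)) n F (\<lambda>_. {}))"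
  define K where "K = (\<lambda>c. mso_type_bound c m (rank F))"
  have rec_E: "recursive_predicate n (\<lambda>xs. E (a xs) (b xs) (c xs))"
    if "recursive n a" "recursive n b" "recursive n c" for n a b c
  proof -
    \<comment> \<open>The formula will be evaluated with all variables empty.\<close>
    let ?gs = "[a, b, c] @ replicate m (\<lambda>_. 0)"
    have gs: "recursive n g" if "g \<in> set ?gs" for g
      using that \<open>recursive n a\<close> \<open>recursive n b\<close> \<open>recursive n c\<close>
      by (auto intro!: recursive_const split: if_splits)
    have "holds T k F (\<lambda>i. set_decode (map (\<lambda>g. g xs) ?gs ! (i + 3))) = holds T k F (\<lambda>_. {})" for T k xs
      by (rule holds_cong_vars[OF F]) (simp add: numeral_3_eq_3)
    moreover have "map (\<lambda>g. g xs) ?gs ! 0 = a xs" "map (\<lambda>g. g xs) ?gs ! 1 = b xs"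
      "map (\<lambda>g. g xs) ?gs ! 2 = c xs" for xs
      by simp_all
    ultimately show ?thesis
      using recursive_predicate_comp[OF recursive_holds[OF F], of ?gs n] gs unfolding E_def
      by (simp del: map_append cong: if_cong)
  qed
  have "recursive_predicate 4 (\<lambda>ys. ys ! 3 = prod_encode (ys ! 2, ys ! 1) \<and> K (ys ! 3) \<le> ys ! 0 \<and>
      E (ys ! 2) (ys ! 1) (ys ! 0))"
    unfolding K_def by (intro recursive_intros rec_E recursive_mso_type_bound) auto
  from recursive_predicate_bex[OF this, where n = 3 and b = "\<lambda>ys. 2 * K (ys ! 2)"]
  have "recursive_predicate 3 (\<lambda>ys. \<exists>n<2 * K (ys ! 2). ys ! 2 = prod_encode (ys ! 1, ys ! 0) \<and>
      K (ys ! 2) \<le> n \<and> E (ys ! 1) (ys ! 0) n)"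
    by (simp add: K_def recursive_intros recursive_mso_type_bound del: mult_Suc mult_2)
  from recursive_predicate_bex[OF this, where n = 2 and b = "\<lambda>ys. Suc (ys ! 1)"]
  have "recursive_predicate 2 (\<lambda>ys. \<exists>q<Suc (ys ! 1). \<exists>n<2 * K (ys ! 1).
      ys ! 1 = prod_encode (ys ! 0, q) \<and> K (ys ! 1) \<le> n \<and> E (ys ! 0) q n)"
    by (simp add: recursive_intros)
  from recursive_predicate_bex[OF this, where n = 1 and b = "\<lambda>ys. Suc (ys ! 0)"]
  have "recursive_predicate 1 (\<lambda>ys. \<exists>p<Suc (ys ! 0). \<exists>q<Suc (ys ! 0). \<exists>n<2 * K (ys ! 0).
      ys ! 0 = prod_encode (p, q) \<and> K (ys ! 0) \<le> n \<and> E p q n)"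
    by (simp add: recursive_intros)
  from recursive_predicate_Not[OF this]
  have rec: "recursive 1 (\<lambda>ys. if \<not> (\<exists>p<Suc (ys ! 0). \<exists>q<Suc (ys ! 0). \<exists>n<2 * K (ys ! 0).
      ys ! 0 = prod_encode (p, q) \<and> K (ys ! 0) \<le> n \<and> E p q n) then 1 else 0)"
    unfolding recursive_predicate_def .
  have iff: "(\<exists>p'<Suc c. \<exists>q'<Suc c. \<exists>n<2 * K c. c = prod_encode (p', q') \<and> K c \<le> n \<and> E p' q' n)
      \<longleftrightarrow> infinite {n. E p q n}" if c: "c = prod_encode (p, q)" for p q c
  proof -
    have le: "p \<le> c" "q \<le> c" unfolding c by (rule le_prod_encode_1 le_prod_encode_2)+
    have "(s, e, w) \<in> shapes (if b then p else q) \<Longrightarrow> s \<le> c \<and> e \<le> c \<and> w \<le> c" for b s e w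
      using shapes_bounded[of s e w p] shapes_bounded[of s e w q] le by (auto split: if_splits)
    then have "infinite {n. E p q n} \<longleftrightarrow> (\<exists>n<2 * K c. K c \<le> n \<and> E p q n)"
      unfolding E_def K_def by (rule infinite_holds_iff[OF _ F])
    moreover have "c = prod_encode (p', q') \<longleftrightarrow> p' = p \<and> q' = q" for p' q'
      unfolding c prod_encode_eq by auto
    ultimately show ?thesis using le by (auto simp: less_Suc_eq_le)
  qed
  show ?thesis
    by (intro exI conjI allI, rule rec) (simp only: nth_Cons_0 iff[OF refl] not_not, simp only: E_def)
qed

section \<open>The decision procedure\<close>

theorem theorem2:
  "decidable fi1_sets_encode {(X, Y). finite X \<and> finite Y}
    (\<lambda>(X, Y). finitely_generated ((subsemigroup hull X) \<inter> (subsemigroup hull Y)))"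
proof -
  obtain f where f: "recursive 1 f" "\<And>p q. f [prod_encode (p, q)] =
      (if finite {n. holds (\<lambda>b. shapes (if b then p else q)) n critical_formula (\<lambda>_. {})} then 1 else 0)"
    using decidable_infinite_holds[OF vars_below_critical_formula] by blast
  have "f [fi1_sets_encode (X, Y)] =
      (if finitely_generated ((subsemigroup hull X) \<inter> (subsemigroup hull Y)) then 1 else 0)"
    if fin: "finite X" "finite Y" for X Y
  proof -
    let ?U = "(subsemigroup hull X) \<inter> (subsemigroup hull Y)"
    let ?p = "set_encode (fi1_encode ` X)" and ?q = "set_encode (fi1_encode ` Y)"
    have "shapes (if b then ?p else ?q) = shape ` (if b then X else Y)" for b
      using fin by (simp add: shapes_set_encode)
    then have "{n. holds (\<lambda>b. shapes (if b then ?p else ?q)) n critical_formula (\<lambda>_. {})} =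
        Suc ` {w. critical ?U w}"
      by (auto simp: holds_critical_formula[of _ X Y])
    then have "finite {n. holds (\<lambda>b. shapes (if b then ?p else ?q)) n critical_formula (\<lambda>_. {})} \<longleftrightarrow>
        finite {w. critical ?U w}"
      by (simp add: finite_image_iff)
    also have "\<dots> \<longleftrightarrow> finitely_generated ?U"
      using subsemigroup_hull[of X] subsemigroup_hull[of Y]
      by (intro finitely_generated_iff_finite_critical[symmetric]) (auto simp: subsemigroup_def)
    finally show ?thesis
      by (simp add: fi1_sets_encode_def f(2))
  qed
  with f(1) show ?thesis
    unfolding decidable_def by (intro exI[of _ f]) auto
qed

end
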